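(* Let $V$ be a Banach $\mathbb O$-bimodule, let $T\in\mathscr B_{\mathcal{RO}}(V)$, let $J\in\mathbb S$ and let $s\in\mathbb C_J$ with $|s|>\|T\|$. Then: (1) For every $x\in\mathbb C_J(V)$ the series $\sum_{n\ge0}\big(T^{\circledcirc n}\odot s^{-1-n}\big)(x)$ and $\sum_{n\ge 0}[T,T^{\circledcirc n},xs^{-1-n}]_{\circledcirc}$ converge in norm and $$(R_s-T)\Big(\sum_{n\ge0}\big(T^{\circledcirc n}\odot s^{-1-n}\big)(x)\Big)=x+\sum_{n\ge0}[T,T^{\circledcirc n},xs^{-1-n}]_{\circledcirc}.$$ (2) For every $x\in V$ the series $\sum_{n\ge0}\big(s^{-1-n}\odot T^{n\circledcirc}\big)(y)$ (for any $y\in V$) and $\sum_{n\ge0}[T^{n\circledcirc},T,x]_{\circledcirc}\,s^{-1-n}$ converge in norm and $$\pi_J\sum_{n\ge0}\big(s^{-1-n}\odot T^{n\circledcirc}\big)\big((R_s-T)(x)\big)=\pi_J x+\pi_J\sum_{n\ge0}[T^{n\circledcirc},T,x]_{\circledcirc}\,s^{-1-n}.$$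
   Context: $\mathbb O$ is the real octonion algebra with basis $e_0=1,e_1,\dots,e_7$, conjugation $\bar x$ and norm $|x|$; $\mathbb S=\{J\in\mathbb O:J^2=-1\}$ and $\mathbb C_J=\mathbb R+\mathbb RJ$. An $\mathbb O$-bimodule is a real vector space $M$ with real-bilinear left and right multiplications by $\mathbb O$ (with $1x=x1=x$) whose associators $[p,q,x]=(pq)x-p(qx)$, $[p,x,q]=(px)q-p(xq)$, $[x,p,q]=(xp)q-x(pq)$ satisfy $[p,q,x]=[q,x,p]=[x,p,q]=-[q,p,x]$ for all $p,q\in\mathbb O,x\in M$. Its real part is $\operatorname{Re}M=\{m\in M: pm=mp,\ [p,q,m]=0\ \forall p,q\in\mathbb O\}$; every $x\in M$ decomposes uniquely as $x=\sum_{i=0}^7 e_ix_i$ with $x_i\in\operatorname{Re}M$, and $\operatorname{Re}x:=x_0$ (equivalently $\operatorname{Re}x=\tfrac5{12}x-\tfrac1{12}\sum_{i=1}^7e_ixe_i$). For $J\in\mathbb S$, $\mathbb C_J(M)=\operatorname{Re}M\oplus J\operatorname{Re}M$ and $\pi_J:M\to\mathbb C_J(M)$, $\pi_J(x)=\operatorname{Re}x+J\operatorname{Re}(\bar Jx)$. A Banach $\mathbb O$-bimodule is an $\mathbb O$-bimodule $V$ with a complete norm such that $\|px\|=\|xp\|=|p|\,\|x\|$. $\mathscr B_{\mathbb R}(V)$ denotes the bounded real-linear operators on $V$, with ordinary composition $TS=T\circ S$ and powers $T^n$ ($T^0=\mathcal I$); for $s\in\mathbb O$, $R_s\in\mathscr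 B_{\mathbb R}(V)$ is $R_sv=vs$. For a real-linear $f$ and $p\in\mathbb O$ set $B_p(f,x)=f(x)p-f(xp)$; $f$ is right para-linear if $\operatorname{Re}B_p(f,x)=0$ for all $p,x$, and octonionic linear if $f(xp)=f(x)p$ for all $p,x$. $\mathscr B_{\mathcal{RO}}(V)$ (resp. $\mathscr B_{\mathbb O}(V)$) is the set of bounded right para-linear (resp. octonionic linear) operators; it is an $\mathbb O$-bimodule via $(p\odot f)(x)=pf(x)+B_p(f,x)$, $(f\odot p)(x)=f(px)-B_p(f,x)$. For real-linear $h:\operatorname{Re}V\to V$, $\operatorname{ext}h\in\mathscr B_{\mathcal{RO}}(V)$ is $(\operatorname{ext}h)(\sum_i x_ie_i)=\sum_i h(x_i)e_i$ ($x_i\in\operatorname{Re}V$); for real-linear $h:V\to\operatorname{Re}V$, $(\operatorname{lif}h)(x)=\sum_{i=0}^7h(x\bar e_i)e_i$. For $T\in\mathscr B_{\mathbb R}(V)$: $T^{\circledcirc n}=\operatorname{ext}(T^n|_{\operatorname{Re}V})$, $T^{n\circledcirc}=\operatorname{lif}(\operatorname{Re}\circ T^n)$. For $f,g\in\mathscr B_{\mathcal{RO}}(V)$ the regular composition is $f\circledcirc g=\operatorname{ext}((f\circ g)|_{\operatorname{Re}V})$ (equivalently $\operatorname{lif}(\operatorname{Re}\circ f\circ g)$), and the composition associator is $[f,g,x]_{\circledcirc}=(f\circledcirc g)(x)-f(g(x))$. *)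

theory Defs
  imports "HOL-Analysis.Analysis"
begin

text \<open>Octonions are represented as vectors in real^8 (Euclidean norm = octonion norm),
 with basis e_0 = 1, e_1, ..., e_7 and the multiplication e_i e_j = +-e_(i xor j),
 signs from the Fano-plane triples below (a standard octonion table).\<close>

type_synonym octo = "real^8"

definition oidx :: "nat \<Rightarrow> 8" where "oidx i = of_nat i"

definition oe :: "nat \<Rightarrow> octo" where "oe i = axis (oidx i) 1"

definition otrip :: "(nat \<times> nat \<times> nat) list" where
  "otrip = [(1,2,3),(1,4,5),(1,7,6),(2,4,6),(2,5,7),(3,4,7),(3,6,5)]"

definition opos :: "nat \<Rightarrow> nat \<Rightarrow> bool" where
  "opos i j = (\<exists>(a,b,c)\<in>set otrip. (i,j) \<in> {(a,b),(b,c),(c,a)})"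

definition osgn :: "nat \<Rightarrow> nat \<Rightarrow> real" where
  "osgn i j = (if i = 0 \<or> j = 0 then 1 else if i = j then -1 else if opos i j then 1 else -1)"

definition omul :: "octo \<Rightarrow> octo \<Rightarrow> octo" where
  "omul x y = (\<Sum>i<8. \<Sum>j<8. (x $ oidx i * y $ oidx j * osgn i j) *\<^sub>R oe (Bit_Operations.xor i j))"

definition ocnj :: "octo \<Rightarrow> octo" where
  "ocnj x = (\<chi> k. if k = 0 then x $ k else - (x $ k))"

definition oinv :: "octo \<Rightarrow> octo" where
  "oinv s = (1 / (norm s)\<^sup>2) *\<^sub>R ocnj s"

primrec opow :: "octo \<Rightarrow> nat \<Rightarrow> octo" where
  "opow s 0 = oe 0"
| "opow s (Suc n) = omul s (opow s n)"

definition oS :: "octo set" where "oS = {J. omul J J = - oe 0}"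

definition oCJ :: "octo \<Rightarrow> octo set" where
  "oCJ J = {a *\<^sub>R oe 0 + b *\<^sub>R J | a b. True}"

definition oasl :: "(octo \<Rightarrow> 'v::real_vector \<Rightarrow> 'v) \<Rightarrow> octo \<Rightarrow> octo \<Rightarrow> 'v \<Rightarrow> 'v" where
  "oasl lm p q x = lm (omul p q) x - lm p (lm q x)"

definition oasm :: "(octo \<Rightarrow> 'v::real_vector \<Rightarrow> 'v) \<Rightarrow> ('v \<Rightarrow> octo \<Rightarrow> 'v) \<Rightarrow> octo \<Rightarrow> 'v \<Rightarrow> octo \<Rightarrow> 'v" where
  "oasm lm rm p x q = rm (lm p x) q - lm p (rm x q)"

definition oasr :: "('v::real_vector \<Rightarrow> octo \<Rightarrow> 'v) \<Rightarrow> 'v \<Rightarrow> octo \<Rightarrow> octo \<Rightarrow> 'v" where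
  "oasr rm x p q = rm (rm x p) q - rm x (omul p q)"

definition obimodule :: "(octo \<Rightarrow> 'v::real_vector \<Rightarrow> 'v) \<Rightarrow> ('v \<Rightarrow> octo \<Rightarrow> 'v) \<Rightarrow> bool" where
  "obimodule lm rm \<longleftrightarrow>
     (\<forall>p. linear (lm p)) \<and> (\<forall>x. linear (\<lambda>p. lm p x)) \<and>
     (\<forall>p. linear (\<lambda>x. rm x p)) \<and> (\<forall>x. linear (rm x)) \<and>
     (\<forall>x. lm (oe 0) x = x \<and> rm x (oe 0) = x) \<and>
     (\<forall>p q x. oasl lm p q x = oasm lm rm q x p \<and>
              oasm lm rm q x p = oasr rm x p q \<and>
              oasr rm x p q = - oasl lm q p x)"

definition banach_obimodule :: "(octo \<Rightarrow> 'v::banach \<Rightarrow> 'v) \<Rightarrow> ('v \<Rightarrow> octo \<Rightarrow> 'v) \<Rightarrow> bool" where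
  "banach_obimodule lm rm \<longleftrightarrow> obimodule lm rm \<and>
     (\<forall>p x. norm (lm p x) = norm p * norm x \<and> norm (rm x p) = norm p * norm x)"

definition ReV :: "(octo \<Rightarrow> 'v::real_vector \<Rightarrow> 'v) \<Rightarrow> ('v \<Rightarrow> octo \<Rightarrow> 'v) \<Rightarrow> 'v set" where
  "ReV lm rm = {m. (\<forall>p. lm p m = rm m p) \<and> (\<forall>p q. oasl lm p q m = 0)}"

definition oRe :: "(octo \<Rightarrow> 'v::real_vector \<Rightarrow> 'v) \<Rightarrow> ('v \<Rightarrow> octo \<Rightarrow> 'v) \<Rightarrow> 'v \<Rightarrow> 'v" where
  "oRe lm rm x = (5/12) *\<^sub>R x - (1/12) *\<^sub>R (\<Sum>i\<in>{1..7}. rm (lm (oe i) x) (oe i))"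

definition ocoords :: "(octo \<Rightarrow> 'v::real_vector \<Rightarrow> 'v) \<Rightarrow> ('v \<Rightarrow> octo \<Rightarrow> 'v) \<Rightarrow> 'v \<Rightarrow> nat \<Rightarrow> 'v" where
  "ocoords lm rm x = (THE xs. (\<forall>i<8. xs i \<in> ReV lm rm) \<and> (\<forall>i\<ge>8. xs i = 0) \<and>
                               x = (\<Sum>i<8. lm (oe i) (xs i)))"

definition oCJV :: "(octo \<Rightarrow> 'v::real_vector \<Rightarrow> 'v) \<Rightarrow> ('v \<Rightarrow> octo \<Rightarrow> 'v) \<Rightarrow> octo \<Rightarrow> 'v set" where
  "oCJV lm rm J = {a + lm J b | a b. a \<in> ReV lm rm \<and> b \<in> ReV lm rm}"

definition opi :: "(octo \<Rightarrow> 'v::real_vector \<Rightarrow> 'v) \<Rightarrow> ('v \<Rightarrow> octo \<Rightarrow> 'v) \<Rightarrow> octo \<Rightarrow> 'v \<Rightarrow> 'v" where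
  "opi lm rm J x = oRe lm rm x + lm J (oRe lm rm (lm (ocnj J) x))"

definition oB :: "('v::real_vector \<Rightarrow> octo \<Rightarrow> 'v) \<Rightarrow> ('v \<Rightarrow> 'v) \<Rightarrow> octo \<Rightarrow> 'v \<Rightarrow> 'v" where
  "oB rm f p x = rm (f x) p - f (rm x p)"

definition right_para_linear :: "(octo \<Rightarrow> 'v::real_vector \<Rightarrow> 'v) \<Rightarrow> ('v \<Rightarrow> octo \<Rightarrow> 'v) \<Rightarrow> ('v \<Rightarrow> 'v) \<Rightarrow> bool" where
  "right_para_linear lm rm f \<longleftrightarrow> linear f \<and> (\<forall>p x. oRe lm rm (oB rm f p x) = 0)"

definition BRO :: "(octo \<Rightarrow> 'v::real_normed_vector \<Rightarrow> 'v) \<Rightarrow> ('v \<Rightarrow> octo \<Rightarrow> 'v) \<Rightarrow> ('v \<Rightarrow> 'v) set" where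
  "BRO lm rm = {f. bounded_linear f \<and> right_para_linear lm rm f}"

definition olact :: "(octo \<Rightarrow> 'v::real_vector \<Rightarrow> 'v) \<Rightarrow> ('v \<Rightarrow> octo \<Rightarrow> 'v) \<Rightarrow> octo \<Rightarrow> ('v \<Rightarrow> 'v) \<Rightarrow> 'v \<Rightarrow> 'v" where
  "olact lm rm p f = (\<lambda>x. lm p (f x) + oB rm f p x)"

definition oract :: "(octo \<Rightarrow> 'v::real_vector \<Rightarrow> 'v) \<Rightarrow> ('v \<Rightarrow> octo \<Rightarrow> 'v) \<Rightarrow> ('v \<Rightarrow> 'v) \<Rightarrow> octo \<Rightarrow> 'v \<Rightarrow> 'v" where
  "oract lm rm f p = (\<lambda>x. f (lm p x) - oB rm f p x)"

text \<open>ext h (sum_i x_i e_i) = sum_i h(x_i) e_i  (h only evaluated on Re V).\<close>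
definition oext :: "(octo \<Rightarrow> 'v::real_vector \<Rightarrow> 'v) \<Rightarrow> ('v \<Rightarrow> octo \<Rightarrow> 'v) \<Rightarrow> ('v \<Rightarrow> 'v) \<Rightarrow> 'v \<Rightarrow> 'v" where
  "oext lm rm h = (\<lambda>x. \<Sum>i<8. rm (h (ocoords lm rm x i)) (oe i))"

definition olif :: "('v::real_vector \<Rightarrow> octo \<Rightarrow> 'v) \<Rightarrow> ('v \<Rightarrow> 'v) \<Rightarrow> 'v \<Rightarrow> 'v" where
  "olif rm h = (\<lambda>x. \<Sum>i<8. rm (h (rm x (ocnj (oe i)))) (oe i))"

definition orpow :: "(octo \<Rightarrow> 'v::real_vector \<Rightarrow> 'v) \<Rightarrow> ('v \<Rightarrow> octo \<Rightarrow> 'v) \<Rightarrow> ('v \<Rightarrow> 'v) \<Rightarrow> nat \<Rightarrow> 'v \<Rightarrow> 'v" where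
  "orpow lm rm T n = oext lm rm (T ^^ n)"

definition olpow :: "(octo \<Rightarrow> 'v::real_vector \<Rightarrow> 'v) \<Rightarrow> ('v \<Rightarrow> octo \<Rightarrow> 'v) \<Rightarrow> ('v \<Rightarrow> 'v) \<Rightarrow> nat \<Rightarrow> 'v \<Rightarrow> 'v" where
  "olpow lm rm T n = olif rm (oRe lm rm \<circ> (T ^^ n))"

definition ocomp :: "(octo \<Rightarrow> 'v::real_vector \<Rightarrow> 'v) \<Rightarrow> ('v \<Rightarrow> octo \<Rightarrow> 'v) \<Rightarrow> ('v \<Rightarrow> 'v) \<Rightarrow> ('v \<Rightarrow> 'v) \<Rightarrow> 'v \<Rightarrow> 'v" where
  "ocomp lm rm f g = oext lm rm (f \<circ> g)"

definition oassoc :: "(octo \<Rightarrow> 'v::real_vector \<Rightarrow> 'v) \<Rightarrow> ('v \<Rightarrow> octo \<Rightarrow> 'v) \<Rightarrow> ('v \<Rightarrow> 'v) \<Rightarrow> ('v \<Rightarrow> 'v) \<Rightarrow> 'v \<Rightarrow> 'v" where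
  "oassoc lm rm f g x = ocomp lm rm f g x - f (g x)"

definition oR :: "('v::real_vector \<Rightarrow> octo \<Rightarrow> 'v) \<Rightarrow> octo \<Rightarrow> 'v \<Rightarrow> 'v" where
  "oR rm s = (\<lambda>v. rm v s)"

end

(* Linearising the alternative laws and summing the Teichmueller identity over the three lines of the
   Fano plane through a unit k expresses the commutator with k by associators.  This forces
   Re x = 5/12 x - 1/12 sum_i e_i x e_i into Re M for every x, and x = sum_i e_i Re(conj(e_i) x).
   Hence identities in M whose terms are linear in x only need to be checked on x = p m with m in Re M.

   (1) On x = a + J b the n-th term of the series is t_n = (T^n a + (T^n b) J) s^(-1-n); here t_0 s = x
   and the n-th composition associator is t_(n+1) s - T t_n.

   (2) pi_J v is determined by the elements Re(v c) with c in C_J.  Lifting gives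
   Re((s^(-1-n) . T^(n)) (y) c) = Re T^n((y c) s^(-1-n)), and Re(([T^(n), T, x] s^(-1-n)) c) equals
   Re T^(n+1)(x c s^(-1-n)) - Re T^n((T x) c s^(-1-n)).  For y = x s - T x the difference of the two
   series telescopes to Re(x c). *)
theory Submission
  imports Defs
begin

section \<open>The octonion table\<close>

text \<open>Arithmetic in the numeral type \<open>8\<close> is decided on literals only, so the
  indices are enumerated. Injectivity permits all later computations to use natural-number
  indices.\<close>

lemma inj_on_oidx: "inj_on oidx {..<8}"
proof -
  have "oidx i \<noteq> oidx j" if "i < j" "j < 8" for i j
  proof -
    have "j = 1 \<or> j = 2 \<or> j = 3 \<or> j = 4 \<or> j = 5 \<or> j = 6 \<or> j = 7"
      "i = 0 \<or> i = 1 \<or> i = 2 \<or> i = 3 \<or> i = 4 \<or> i = 5 \<or> i = 6"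
      using that by linarith+
    then show ?thesis using that by (elim disjE) (simp_all add: oidx_def)
  qed
  then show ?thesis
    by (intro linorder_inj_onI) auto
qed

lemma oidx_eq_iff: "i < 8 \<Longrightarrow> j < 8 \<Longrightarrow> oidx i = oidx j \<longleftrightarrow> i = j"
  using inj_on_oidx by (auto simp: inj_on_def)

lemma bij_betw_oidx: "bij_betw oidx {..<8} UNIV"
  unfolding bij_betw_def
  by (simp add: inj_on_oidx card_image card_subset_eq)

lemma oe_nth: "i < 8 \<Longrightarrow> j < 8 \<Longrightarrow> oe i $ oidx j = (if i = j then 1 else 0)"
  by (simp add: oe_def axis_def oidx_eq_iff)

lemma octo_eqI: "(\<And>i. i < 8 \<Longrightarrow> x $ oidx i = y $ oidx i) \<Longrightarrow> x = (y::octo)"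
  using bij_betw_imp_surj_on[OF bij_betw_oidx]
  by (metis UNIV_I imageE lessThan_iff vec_eq_iff)

lemma inner_octo: "(x::octo) \<bullet> y = (\<Sum>i<8. x $ oidx i * y $ oidx i)"
  unfolding inner_vec_def inner_real_def
  by (rule sum.reindex_bij_betw[OF bij_betw_oidx, symmetric])

lemma octo_expansion: "(\<Sum>i<8. (x $ oidx i) *\<^sub>R oe i) = x"
  by (rule octo_eqI) (simp add: oe_nth if_distrib cong: if_cong)

lemma linear_omul_left: "linear (\<lambda>x. omul x y)"
  unfolding omul_def
  by (rule linearI)
     (simp_all add: distrib_right scaleR_left_distrib sum.distrib scaleR_sum_right mult.assoc)

lemma linear_omul_right: "linear (omul x)"
  unfolding omul_def
  by (rule linearI)
     (simp_all add: distrib_left distrib_right scaleR_left_distrib sum.distrib scaleR_sum_right mult.assoc mult.left_commute)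

lemmas omul_linear =
  linear_add[OF linear_omul_left] linear_add[OF linear_omul_right]
  linear_diff[OF linear_omul_left] linear_diff[OF linear_omul_right]
  linear_neg[OF linear_omul_left] linear_neg[OF linear_omul_right]
  linear_scale[OF linear_omul_left] linear_scale[OF linear_omul_right]
  linear_0[OF linear_omul_left] linear_0[OF linear_omul_right]
  linear_sum[OF linear_omul_left] linear_sum[OF linear_omul_right]

lemma omul_oe:
  assumes "i < 8" "j < 8"
  shows "omul (oe i) (oe j) = osgn i j *\<^sub>R oe (Bit_Operations.xor i j)"
proof -
  have "(oe i $ oidx k * oe j $ oidx l * osgn k l) *\<^sub>R oe (Bit_Operations.xor k l)
      = (if l = j then if k = i then osgn i j *\<^sub>R oe (Bit_Operations.xor i j) else 0 else 0)"
    if "k < 8" "l < 8" for k l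
    using that assms by (simp add: oe_nth)
  then show ?thesis
    using assms unfolding omul_def by simp
qed

lemma sum_lessThan_8: "(\<Sum>i<8. f i) = f 0 + f 1 + f 2 + f 3 + f 4 + f 5 + f 6 + f (7::nat)"
  for f :: "nat \<Rightarrow> 'a::comm_monoid_add"
  by (simp add: eval_nat_numeral add.assoc)

lemma sum_atLeastAtMost_1_7: "(\<Sum>i\<in>{1..7}. f i) = f 1 + f 2 + f 3 + f 4 + f 5 + f 6 + f (7::nat)"
  for f :: "nat \<Rightarrow> 'a::comm_monoid_add"
  by (simp add: eval_nat_numeral add.assoc)

lemma omul_oe_0 [simp]: "omul (oe 0) x = x" "omul x (oe 0) = x"
proof -
  have "omul (oe 0) (oe i) = oe i" "omul (oe i) (oe 0) = oe i" if "i < 8" for i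
    using that by (simp_all add: omul_oe osgn_def)
  then have "omul (oe 0) (\<Sum>i<8. (x $ oidx i) *\<^sub>R oe i) = (\<Sum>i<8. (x $ oidx i) *\<^sub>R oe i)"
    "omul (\<Sum>i<8. (x $ oidx i) *\<^sub>R oe i) (oe 0) = (\<Sum>i<8. (x $ oidx i) *\<^sub>R oe i)"
    by (simp_all add: omul_linear)
  then show "omul (oe 0) x = x" "omul x (oe 0) = x"
    unfolding octo_expansion .
qed

lemmas osgn_simps = osgn_def opos_def otrip_def

lemma omul_nth_0:
  "omul x y $ oidx 0 = x $ oidx 0 * y $ oidx 0 - (\<Sum>i\<in>{1..7}. x $ oidx i * y $ oidx i)"
  unfolding omul_def sum_lessThan_8 sum_atLeastAtMost_1_7
  by (simp add: oe_nth osgn_simps)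

lemma omul_nth:
  "omul x y $ oidx 1 = x$oidx 0 * y$oidx 1 + x$oidx 1 * y$oidx 0 + x$oidx 2 * y$oidx 3 - x$oidx 3 * y$oidx 2
     + x$oidx 4 * y$oidx 5 - x$oidx 5 * y$oidx 4 + x$oidx 7 * y$oidx 6 - x$oidx 6 * y$oidx 7"
  "omul x y $ oidx 2 = x$oidx 0 * y$oidx 2 + x$oidx 2 * y$oidx 0 + x$oidx 3 * y$oidx 1 - x$oidx 1 * y$oidx 3
     + x$oidx 4 * y$oidx 6 - x$oidx 6 * y$oidx 4 + x$oidx 5 * y$oidx 7 - x$oidx 7 * y$oidx 5"
  "omul x y $ oidx 3 = x$oidx 0 * y$oidx 3 + x$oidx 3 * y$oidx 0 + x$oidx 1 * y$oidx 2 - x$oidx 2 * y$oidx 1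
     + x$oidx 4 * y$oidx 7 - x$oidx 7 * y$oidx 4 + x$oidx 6 * y$oidx 5 - x$oidx 5 * y$oidx 6"
  "omul x y $ oidx 4 = x$oidx 0 * y$oidx 4 + x$oidx 4 * y$oidx 0 + x$oidx 5 * y$oidx 1 - x$oidx 1 * y$oidx 5
     + x$oidx 6 * y$oidx 2 - x$oidx 2 * y$oidx 6 + x$oidx 7 * y$oidx 3 - x$oidx 3 * y$oidx 7"
  "omul x y $ oidx 5 = x$oidx 0 * y$oidx 5 + x$oidx 5 * y$oidx 0 + x$oidx 1 * y$oidx 4 - x$oidx 4 * y$oidx 1
     + x$oidx 7 * y$oidx 2 - x$oidx 2 * y$oidx 7 + x$oidx 3 * y$oidx 6 - x$oidx 6 * y$oidx 3"
  "omul x y $ oidx 6 = x$oidx 0 * y$oidx 6 + x$oidx 6 * y$oidx 0 + x$oidx 1 * y$oidx 7 - x$oidx 7 * y$oidx 1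
     + x$oidx 2 * y$oidx 4 - x$oidx 4 * y$oidx 2 + x$oidx 5 * y$oidx 3 - x$oidx 3 * y$oidx 5"
  "omul x y $ oidx 7 = x$oidx 0 * y$oidx 7 + x$oidx 7 * y$oidx 0 + x$oidx 6 * y$oidx 1 - x$oidx 1 * y$oidx 6
     + x$oidx 2 * y$oidx 5 - x$oidx 5 * y$oidx 2 + x$oidx 3 * y$oidx 4 - x$oidx 4 * y$oidx 3"
  unfolding omul_def sum_lessThan_8
  by (simp_all add: oe_nth osgn_simps)

section \<open>The real component as a trace, imaginary units and conjugation\<close>

lemma omul_trace_commute: "omul x y $ oidx 0 = omul y x $ oidx 0"
  by (simp add: omul_nth_0 mult.commute)

text \<open>Octonion associators are purely imaginary; this is seen by expanding all coordinates. It
  is the source of the associativity of \<open>re\<close> under right multiplications.\<close>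

lemma omul_trace_assoc: "omul (omul x y) z $ oidx 0 = omul x (omul y z) $ oidx 0"
  unfolding omul_nth_0 sum_atLeastAtMost_1_7 omul_nth
  by (simp only: algebra_simps)

lemma oS_imaginary_unit:
  assumes "J \<in> oS" shows "J $ oidx 0 = 0" "norm J = 1"
proof -
  have J: "omul J J = - oe 0" using assms by (simp add: oS_def)
  have 0: "(J $ oidx 0)\<^sup>2 - (\<Sum>i\<in>{1..7}. (J $ oidx i)\<^sup>2) = -1"
    using arg_cong[OF J, of "\<lambda>x. x $ oidx 0"] by (simp add: omul_nth_0 oe_nth power2_eq_square)
  \<comment> \<open>In the i-th coordinate of \<open>omul J J\<close> the antisymmetric cross terms
    cancel, which leaves twice this product.\<close>
  have i: "J $ oidx 0 * J $ oidx i = 0" if "i \<in> {1..7}" for i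
  proof -
    have "i = 1 \<or> i = 2 \<or> i = 3 \<or> i = 4 \<or> i = 5 \<or> i = 6 \<or> i = 7" using that by auto
    moreover have "omul J J $ oidx i = 0" using that J by (simp add: oe_nth)
    ultimately show ?thesis by (elim disjE) (simp_all only: omul_nth, simp_all add: mult.commute)
  qed
  show z: "J $ oidx 0 = 0"
  proof (rule ccontr)
    assume "J $ oidx 0 \<noteq> 0"
    with i have "(\<Sum>i\<in>{1..7}. (J $ oidx i)\<^sup>2) = 0" by simp
    with 0 have "(J $ oidx 0)\<^sup>2 = -1" by simp
    then show False using zero_le_power2[of "J $ oidx 0"] by linarith
  qed
  have "(norm J)\<^sup>2 = (\<Sum>i<8. (J $ oidx i)\<^sup>2)"
    unfolding power2_norm_eq_inner inner_octo by (simp only: power2_eq_square)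
  also have "\<dots> = 1"
    using 0 z unfolding sum_lessThan_8 sum_atLeastAtMost_1_7 by simp
  finally show "norm J = 1" using norm_ge_zero[of J] unfolding power2_eq_1_iff by linarith
qed

lemma ocnj_nth: "j < 8 \<Longrightarrow> ocnj x $ oidx j = (if j = 0 then x $ oidx j else - (x $ oidx j))"
  using oidx_eq_iff[of j 0] by (simp add: ocnj_def oidx_def)

lemma ocnj_oe: "i < 8 \<Longrightarrow> ocnj (oe i) = (if i = 0 then oe 0 else - oe i)"
  by (intro octo_eqI) (auto simp: ocnj_nth oe_nth)

lemma sum_oe_nth_mult:
  "i < 8 \<Longrightarrow> (\<Sum>j\<in>{1..7}. oe i $ oidx j * c $ oidx j) = (if i = 0 then 0 else c $ oidx i)"
proof -
  assume i: "i < 8"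
  then have "(\<Sum>j\<in>{1..7}. oe i $ oidx j * c $ oidx j) = (\<Sum>j\<in>{1..7}. if j = i then c $ oidx i else 0)"
    by (intro sum.cong) (auto simp: oe_nth)
  then show ?thesis using i by auto
qed

lemma omul_oe_trace:
  assumes "i < 8"
  shows "omul (oe i) c $ oidx 0 = (if i = 0 then c $ oidx 0 else - c $ oidx i)"
  unfolding omul_nth_0 sum_oe_nth_mult[OF assms] using assms by (simp add: oe_nth)

lemma omul_ocnj_oe_trace: "i < 8 \<Longrightarrow> omul (ocnj (oe i)) c $ oidx 0 = c $ oidx i"
  by (simp add: ocnj_oe omul_linear omul_oe_trace)

text \<open>For i > 0 the trace of \<open>omul (oe i) c\<close> is minus the i-th coordinate of c,
  and \<open>ocnj (oe i)\<close> carries the same sign. This is the form in which c reappears in the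
  pairing with a lifting.\<close>

lemma ocnj_expansion: "(\<Sum>i<8. (omul (oe i) c $ oidx 0) *\<^sub>R ocnj (oe i)) = c"
proof -
  have "(\<Sum>i<8. (omul (oe i) c $ oidx 0) *\<^sub>R ocnj (oe i)) = (\<Sum>i<8. (c $ oidx i) *\<^sub>R oe i)"
    by (intro sum.cong) (auto simp: ocnj_oe omul_oe_trace)
  then show ?thesis unfolding octo_expansion .
qed

lemma norm_ocnj: "norm (ocnj p) = norm p"
proof -
  have "(norm (ocnj p))\<^sup>2 = (norm p)\<^sup>2"
    unfolding power2_norm_eq_inner inner_octo by (intro sum.cong) (auto simp: ocnj_nth)
  then show ?thesis by (simp add: power2_eq_iff_nonneg)
qed

lemma norm_oe: "norm (oe i) = 1"
  by (simp add: oe_def norm_axis_1)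

section \<open>The planes spanned by 1 and an imaginary unit\<close>

text \<open>Pairs (a, b) serve as complex-number coordinates on the plane, so that its arithmetic
  reduces to real algebra.\<close>

definition cj :: "octo \<Rightarrow> real \<Rightarrow> real \<Rightarrow> octo" where
  "cj J a b = a *\<^sub>R oe 0 + b *\<^sub>R J"

lemma oCJ_iff: "p \<in> oCJ J \<longleftrightarrow> (\<exists>a b. p = cj J a b)"
  by (simp add: oCJ_def cj_def)

lemma omul_cj: "J \<in> oS \<Longrightarrow> omul (cj J a b) (cj J c d) = cj J (a * c - b * d) (a * d + b * c)"
  by (simp add: cj_def oS_def omul_linear algebra_simps)

lemma oCJ_omul: "J \<in> oS \<Longrightarrow> p \<in> oCJ J \<Longrightarrow> q \<in> oCJ J \<Longrightarrow> omul p q \<in> oCJ J"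
  unfolding oCJ_iff using omul_cj by metis

lemma oCJ_commute: "J \<in> oS \<Longrightarrow> p \<in> oCJ J \<Longrightarrow> q \<in> oCJ J \<Longrightarrow> omul p q = omul q p"
  unfolding oCJ_iff by (auto simp: omul_cj algebra_simps)

lemma oCJ_assoc:
  "J \<in> oS \<Longrightarrow> p \<in> oCJ J \<Longrightarrow> q \<in> oCJ J \<Longrightarrow> r \<in> oCJ J \<Longrightarrow> omul (omul p q) r = omul p (omul q r)"
  unfolding oCJ_iff by (auto simp: omul_cj algebra_simps)

lemma oCJ_basic: "oe 0 \<in> oCJ J" "J \<in> oCJ J"
  unfolding oCJ_iff cj_def
  by (metis add.right_neutral scaleR_one scaleR_zero_left, metis add.left_neutral scaleR_one scaleR_zero_left)

lemma norm_cj: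
  assumes "J \<in> oS" shows "(norm (cj J a b))\<^sup>2 = a\<^sup>2 + b\<^sup>2"
proof -
  have "oe 0 \<bullet> J = 0"
    unfolding inner_octo using oS_imaginary_unit(1)[OF assms] by (intro sum.neutral) (auto simp: oe_nth)
  moreover have "oe 0 \<bullet> oe 0 = 1"
    unfolding inner_octo by (simp add: sum_lessThan_8 oe_nth)
  moreover have "J \<bullet> J = 1"
    using oS_imaginary_unit(2)[OF assms] by (simp add: norm_eq_1)
  ultimately show ?thesis
    unfolding power2_norm_eq_inner cj_def
    by (simp add: inner_add_left inner_add_right inner_commute[of J "oe 0"] power2_eq_square)
qed

text \<open>After squaring, this is the two-squares identity for products of complex
  numbers.\<close>

lemma norm_omul_oCJ:
  assumes "J \<in> oS" "p \<in> oCJ J" "q \<in> oCJ J"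
  shows "norm (omul p q) = norm p * norm q"
proof -
  obtain a b c d where "p = cj J a b" "q = cj J c d" using assms unfolding oCJ_iff by blast
  then have "(norm (omul p q))\<^sup>2 = (norm p * norm q)\<^sup>2"
    using assms(1) unfolding power_mult_distrib
    by (simp add: omul_cj norm_cj) (simp add: power2_eq_square algebra_simps)
  then show ?thesis by (simp add: power2_eq_iff_nonneg)
qed

lemma ocnj_cj:
  assumes "J \<in> oS" shows "ocnj (cj J a b) = cj J a (- b)"
  using oS_imaginary_unit(1)[OF assms]
  by (intro octo_eqI) (simp add: ocnj_nth cj_def oe_nth)

lemma ocnj_oCJ: "J \<in> oS \<Longrightarrow> p \<in> oCJ J \<Longrightarrow> ocnj p \<in> oCJ J"
  unfolding oCJ_iff using ocnj_cj by metis

lemma oinv_cj: "J \<in> oS \<Longrightarrow> oinv (cj J a b) = cj J (a / (a\<^sup>2 + b\<^sup>2)) (- b / (a\<^sup>2 + b\<^sup>2))"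
  unfolding oinv_def norm_cj ocnj_cj by (simp add: cj_def scaleR_diff_right)

lemma oinv_oCJ: "J \<in> oS \<Longrightarrow> s \<in> oCJ J \<Longrightarrow> oinv s \<in> oCJ J"
  unfolding oCJ_iff using oinv_cj by metis

lemma omul_oinv:
  assumes "J \<in> oS" "s \<in> oCJ J" "s \<noteq> 0"
  shows "omul s (oinv s) = oe 0"
proof -
  obtain a b where s: "s = cj J a b" using assms unfolding oCJ_iff by blast
  have "(norm s)\<^sup>2 \<noteq> 0" using assms(3) by simp
  then have "a\<^sup>2 + b\<^sup>2 \<noteq> 0" unfolding s norm_cj[OF assms(1)] .
  then have "a * (a / (a\<^sup>2 + b\<^sup>2)) - b * (- b / (a\<^sup>2 + b\<^sup>2)) = 1" "a * (- b / (a\<^sup>2 + b\<^sup>2)) + b * (a / (a\<^sup>2 + b\<^sup>2)) = 0"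
    by (simp_all add: power2_eq_square divide_simps)
  then show ?thesis
    unfolding s oinv_cj[OF assms(1)] omul_cj[OF assms(1)] by (simp add: cj_def)
qed

lemma norm_oinv: "norm (oinv s) = inverse (norm s)"
  by (simp add: oinv_def norm_ocnj power2_eq_square divide_simps)

lemma opow_oCJ: "J \<in> oS \<Longrightarrow> p \<in> oCJ J \<Longrightarrow> opow p n \<in> oCJ J"
  by (induction n) (simp_all add: oCJ_basic oCJ_omul)

lemma norm_opow:
  assumes "J \<in> oS" "p \<in> oCJ J" shows "norm (opow p n) = norm p ^ n"
proof (induction n)
  case 0
  show ?case by (simp add: norm_oe)
next
  case (Suc n)
  then show ?case using norm_omul_oCJ[OF assms opow_oCJ[OF assms]] by simp
qed

lemma omul_opow_oinv:
  assumes "J \<in> oS" "s \<in> oCJ J" "s \<noteq> 0"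
  shows "omul s (opow (oinv s) (Suc n)) = opow (oinv s) n"
proof -
  have "oinv s \<in> oCJ J" by (rule oinv_oCJ[OF assms(1,2)])
  then show ?thesis
    using oCJ_assoc[OF assms(1,2) _ opow_oCJ[OF assms(1)], of "oinv s" "oinv s" n]
    by (simp add: omul_oinv[OF assms])
qed

section \<open>The real part of an octonionic bimodule\<close>

text \<open>The elements p, q and \<open>omul p q\<close> multiply like the quaternion units i, j
  and k = ij. Products are listed explicitly so that rewriting needs no associativity of
  \<open>omul\<close>.\<close>

definition quaternionic_pair :: "octo \<Rightarrow> octo \<Rightarrow> bool" where
  "quaternionic_pair p q \<longleftrightarrow>
     omul p p = - oe 0 \<and> omul q q = - oe 0 \<and> omul q p = - omul p q \<and>
     omul (omul p q) (omul p q) = - oe 0 \<and>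
     omul p (omul p q) = - q \<and> omul (omul p q) p = q \<and>
     omul q (omul p q) = p \<and> omul (omul p q) q = - p"

lemma quaternionic_pairD:
  assumes "quaternionic_pair p q"
  shows "omul p p = - oe 0" "omul q q = - oe 0" "omul q p = - omul p q"
    "omul (omul p q) (omul p q) = - oe 0"
    "omul p (omul p q) = - q" "omul (omul p q) p = q" "omul q (omul p q) = p" "omul (omul p q) q = - p"
  using assms unfolding quaternionic_pair_def by blast+

text \<open>The lines of the Fano plane through the unit \<open>k\<close> are \<open>{k, p, p k}\<close>, \<open>{k, q, q k}\<close> and \<open>{k, r, r k}\<close>.\<close>
definition fano_pencil :: "octo \<Rightarrow> octo \<Rightarrow> octo \<Rightarrow> octo \<Rightarrow> bool" where
  "fano_pencil k p q r \<longleftrightarrow>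
     quaternionic_pair p k \<and> quaternionic_pair q k \<and> quaternionic_pair r k \<and>
     omul q p = - omul p q \<and> omul r q = - omul q r \<and> omul p r = - omul r p \<and>
     omul p k = omul q r \<and> omul q k = omul r p \<and> omul r k = omul p q"

lemmas oe_mult_simps = omul_oe osgn_simps omul_linear numeral_2_eq_2[symmetric]

text \<open>One point is taken from each line through the unit. The choices are tied together:
  replacing a point by the other one on its line can break the cyclic relations.\<close>

lemma fano_pencil_oe:
  "fano_pencil (oe 1) (oe 2) (oe 5) (oe 6)"
  "fano_pencil (oe 2) (oe 1) (oe 4) (oe 7)"
  "fano_pencil (oe 3) (oe 1) (oe 6) (oe 4)"
  "fano_pencil (oe 4) (oe 1) (oe 3) (oe 6)"
  "fano_pencil (oe 5) (oe 1) (oe 2) (oe 6)"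
  "fano_pencil (oe 6) (oe 1) (oe 4) (oe 3)"
  "fano_pencil (oe 7) (oe 1) (oe 2) (oe 4)"
  by (simp_all add: fano_pencil_def quaternionic_pair_def oe_mult_simps)

section \<open>Associator calculus in an octonionic bimodule\<close>

locale octonion_bimodule =
  fixes lm :: "octo \<Rightarrow> 'v::real_vector \<Rightarrow> 'v" and rm :: "'v \<Rightarrow> octo \<Rightarrow> 'v"
  assumes obimodule: "obimodule lm rm"
begin

lemma linear_lm: "linear (lm p)" "linear (\<lambda>p. lm p x)"
  and linear_rm: "linear (\<lambda>x. rm x p)" "linear (rm x)"
  using obimodule unfolding obimodule_def by blast+

lemma unit_simps [simp]: "lm (oe 0) x = x" "rm x (oe 0) = x"
  using obimodule unfolding obimodule_def by blast+

lemmas add_simps =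
  linear_add[OF linear_lm(1)] linear_add[OF linear_lm(2)]
  linear_add[OF linear_rm(1)] linear_add[OF linear_rm(2)]
  linear_diff[OF linear_lm(1)] linear_diff[OF linear_lm(2)]
  linear_diff[OF linear_rm(1)] linear_diff[OF linear_rm(2)]

lemmas scale_simps [simp] =
  linear_neg[OF linear_lm(1)] linear_neg[OF linear_lm(2)]
  linear_neg[OF linear_rm(1)] linear_neg[OF linear_rm(2)]
  linear_scale[OF linear_lm(1)] linear_scale[OF linear_lm(2)]
  linear_scale[OF linear_rm(1)] linear_scale[OF linear_rm(2)]
  linear_0[OF linear_lm(1)] linear_0[OF linear_lm(2)]
  linear_0[OF linear_rm(1)] linear_0[OF linear_rm(2)]

lemmas sum_simps =
  linear_sum[OF linear_lm(1)] linear_sum[OF linear_lm(2)]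
  linear_sum[OF linear_rm(1)] linear_sum[OF linear_rm(2)]

abbreviation asc :: "octo \<Rightarrow> octo \<Rightarrow> 'v \<Rightarrow> 'v" where
  "asc \<equiv> oasl lm"

lemma asc_left: "asc p q x = lm (omul p q) x - lm p (lm q x)"
  by (simp add: oasl_def)

text \<open>The bimodule axioms identify the left, middle and right associators. Later proofs expand
  each associator in whichever of the three forms makes terms cancel.\<close>

lemma asc_mid: "asc p q x = rm (lm q x) p - lm q (rm x p)"
  and asc_right: "asc p q x = rm (rm x p) q - rm x (omul p q)"
  and asc_swap: "asc q p x = - asc p q x"
  using obimodule unfolding obimodule_def oasm_def oasr_def by metis+

lemma asc_self [simp]: "asc p p x = 0"
proof -
  have "asc p p x + asc p p x = 0"
    using asc_swap[of p p x] by (simp only: eq_neg_iff_add_eq_0)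
  then have "2 *\<^sub>R asc p p x = 0" by (simp only: scaleR_2)
  then show ?thesis by simp
qed

lemma lm_lm: "lm p (lm q x) = lm (omul p q) x - asc p q x"
  by (simp add: asc_left)

lemma rm_rm: "rm (rm x p) q = rm x (omul p q) + asc p q x"
  by (simp add: asc_right)

lemma lm_square: "lm p (lm p x) = lm (omul p p) x"
  by (simp add: lm_lm)

lemma rm_square: "rm (rm x p) p = rm x (omul p p)"
  by (simp add: rm_rm)

lemma rm_lm_self: "rm (lm p x) p = lm p (rm x p)"
  using asc_mid[of p p x] by simp

text \<open>Linearised alternative law: the associators of the two orders are opposite, so
  anticommutation passes from octonions to the multiplication operators.\<close>

lemma lm_anticommute: "omul q p = - omul p q \<Longrightarrow> lm q (lm p x) = - lm p (lm q x)"
  by (simp add: lm_lm asc_swap[of p q])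

lemma rm_anticommute: "omul q p = - omul p q \<Longrightarrow> rm (rm x q) p = - rm (rm x p) q"
  by (simp add: rm_rm asc_swap[of p q])

text \<open>This is the Teichmueller identity for the four factors p, x, q, r in this order.
  Expanded in suitable forms, both sides become ((p x) q) r - (p (x q)) r + p ((x q) r) - p (x (q
  r)).\<close>

lemma teichmueller:
  "asc q r (lm p x) - asc r p (rm x q) + asc (omul q r) p x = lm p (asc q r x) - rm (asc p q x) r"
proof -
  have 1: "asc q r (lm p x) = rm (rm (lm p x) q) r - rm (lm p x) (omul q r)" by (rule asc_right)
  have 2: "asc r p (rm x q) = rm (lm p (rm x q)) r - lm p (rm (rm x q) r)" by (rule asc_mid)
  have 3: "asc (omul q r) p x = rm (lm p x) (omul q r) - lm p (rm x (omul q r))" by (rule asc_mid)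
  have 4: "asc q r x = rm (rm x q) r - rm x (omul q r)" by (rule asc_right)
  have 5: "asc p q x = - (rm (lm p x) q - lm p (rm x q))"
    by (simp only: asc_mid[symmetric] asc_swap[of q p] minus_minus)
  show ?thesis unfolding 1 2 3 4 5 by (simp add: add_simps)
qed

text \<open>Moving p past both r and q changes the sign twice, so those triple products cancel.
  Moving p past \<open>omul q r\<close> changes it once, so that product is counted twice.\<close>

lemma asc_lm_commutator:
  assumes "omul q p = - omul p q" "omul p r = - omul r p" "omul p (omul q r) = - omul (omul q r) p"
  shows "asc q r (lm p x) - lm p (asc q r x) = 2 *\<^sub>R (lm (omul (omul q r) p) x - asc (omul q r) p x)"
proof -
  have "lm q (lm r (lm p x)) = lm p (lm q (lm r x))"
    using lm_anticommute[OF assms(2), of x] lm_anticommute[OF assms(1), of "lm r x"] by simp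
  moreover have "lm p (lm (omul q r) x) = - lm (omul q r) (lm p x)"
    by (rule lm_anticommute[OF assms(3)])
  moreover have "lm (omul (omul q r) p) x - asc (omul q r) p x = lm (omul q r) (lm p x)"
    by (simp add: asc_left)
  ultimately show ?thesis
    by (simp add: asc_left[of q r] add_simps scaleR_2)
qed

lemma asc_rm_commutator:
  assumes "omul q p = - omul p q" "omul p r = - omul r p" "omul p (omul q r) = - omul (omul q r) p"
  shows "rm (asc q r x) p - asc q r (rm x p) = - 2 *\<^sub>R (rm x (omul (omul q r) p) + asc (omul q r) p x)"
proof -
  have "rm (rm (rm x q) r) p = rm (rm (rm x p) q) r"
    using rm_anticommute[OF assms(2), of "rm x q"] rm_anticommute[OF assms(1), of x] by simp
  moreover have "rm (rm x p) (omul q r) = - rm (rm x (omul q r)) p"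
    by (rule rm_anticommute[OF assms(3)])
  moreover have "rm x (omul (omul q r) p) + asc (omul q r) p x = rm (rm x (omul q r)) p"
    by (simp add: asc_right)
  ultimately show ?thesis
    by (simp add: asc_right[of q r] add_simps scaleR_2)
qed

text \<open>Both commutators of \<open>asc q r\<close> with a multiplication by \<open>p\<close> contain \<open>asc (omul q r) p\<close>, so
  the cyclic sum of the Teichmueller identity becomes a linear equation for the sum of associators.\<close>
lemma asc_pencil_sum:
  assumes "fano_pencil k p q r"
  shows "asc (omul p k) p x + asc (omul q k) q x + asc (omul r k) r x = 2 *\<^sub>R (lm k x - rm x k)"
proof -
  note F = assms[unfolded fano_pencil_def]
  have Q: "quaternionic_pair p k" "quaternionic_pair q k" "quaternionic_pair r k"
    and l: "omul p k = omul q r" "omul q k = omul r p" "omul r k = omul p q"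
    and c: "omul q p = - omul p q" "omul r q = - omul q r" "omul p r = - omul r p"
    using F by blast+
  note Q1 = quaternionic_pairD[OF Q(1)] and Q2 = quaternionic_pairD[OF Q(2)] and Q3 = quaternionic_pairD[OF Q(3)]
  have k: "omul (omul q r) p = k" "omul (omul r p) q = k" "omul (omul p q) r = k"
    using Q1(6) Q2(6) Q3(6) unfolding l by blast+
  have k': "omul p (omul q r) = - omul (omul q r) p" "omul q (omul r p) = - omul (omul r p) q"
    "omul r (omul p q) = - omul (omul p q) r"
    using Q1(5) Q2(5) Q3(5) unfolding l k by blast+
  define P where "P = asc (omul q r) p x"
  define Q where "Q = asc (omul r p) q x"
  define R where "R = asc (omul p q) r x"
  have t: "asc q r (lm p x) - lm p (asc q r x) + (rm (asc p q x) r - asc r p (rm x q)) + P = 0"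
    "asc r p (lm q x) - lm q (asc r p x) + (rm (asc q r x) p - asc p q (rm x r)) + Q = 0"
    "asc p q (lm r x) - lm r (asc p q x) + (rm (asc r p x) q - asc q r (rm x p)) + R = 0"
    using teichmueller[of q r p x] teichmueller[of r p q x] teichmueller[of p q r x]
    unfolding P_def Q_def R_def by (simp_all add: algebra_simps)
  have L: "asc q r (lm p x) - lm p (asc q r x) = 2 *\<^sub>R (lm k x - P)"
    "asc r p (lm q x) - lm q (asc r p x) = 2 *\<^sub>R (lm k x - Q)"
    "asc p q (lm r x) - lm r (asc p q x) = 2 *\<^sub>R (lm k x - R)"
    using asc_lm_commutator[of q p r x] asc_lm_commutator[of r q p x] asc_lm_commutator[of p r q x]
    unfolding P_def Q_def R_def using c k k' by simp_all
  have R': "rm (asc q r x) p - asc q r (rm x p) = - 2 *\<^sub>R (rm x k + P)"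
    "rm (asc r p x) q - asc r p (rm x q) = - 2 *\<^sub>R (rm x k + Q)"
    "rm (asc p q x) r - asc p q (rm x r) = - 2 *\<^sub>R (rm x k + R)"
    using asc_rm_commutator[of q p r x] asc_rm_commutator[of r q p x] asc_rm_commutator[of p r q x]
    unfolding P_def Q_def R_def using c k k' by simp_all
  \<comment> \<open>Only the cyclic sum allows the right multiplications to be regrouped into
    commutators: \<open>rm (asc q r x) p\<close> stems from the second instance and
    \<open>asc q r (rm x p)\<close> from the third.\<close>
  have "(asc q r (lm p x) - lm p (asc q r x)) + (asc r p (lm q x) - lm q (asc r p x)) + (asc p q (lm r x) - lm r (asc p q x))
    + (rm (asc q r x) p - asc q r (rm x p)) + (rm (asc r p x) q - asc r p (rm x q)) + (rm (asc p q x) r - asc p q (rm x r))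
    + (P + Q + R) = 0"
    using arg_cong2[where f="(+)", OF arg_cong2[where f="(+)", OF t(1) t(2)] t(3)]
    by (simp add: algebra_simps)
  then have "2 *\<^sub>R (lm k x - P) + 2 *\<^sub>R (lm k x - Q) + 2 *\<^sub>R (lm k x - R)
    + - 2 *\<^sub>R (rm x k + P) + - 2 *\<^sub>R (rm x k + Q) + - 2 *\<^sub>R (rm x k + R) + (P + Q + R) = 0"
    unfolding L R' .
  moreover have "3 *\<^sub>R y = y + y + y" "6 *\<^sub>R y = y + y + y + y + y + y" for y :: 'v
    using scaleR_left_distrib[of 2 1 y] scaleR_left_distrib[of 3 3 y] by (simp_all add: scaleR_2)
  \<comment> \<open>The commutators contribute 6 (k x - x k) - 4 (P + Q + R), and the identities add
    P + Q + R once more.\<close>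
  ultimately have "3 *\<^sub>R (P + Q + R) = 3 *\<^sub>R (2 *\<^sub>R (lm k x - rm x k))"
    by (simp add: algebra_simps scaleR_2)
  then show ?thesis unfolding l scaleR_cancel_left P_def Q_def R_def by simp
qed

section \<open>The sandwich operators \<open>p x p\<close> and their commutators\<close>

definition U :: "octo \<Rightarrow> 'v \<Rightarrow> 'v" where
  "U p x = rm (lm p x) p"

lemma U_uminus [simp]: "U (- p) x = U p x"
  by (simp add: U_def)

lemma linear_U: "linear (U p)"
  unfolding U_def using linear_compose[OF linear_lm(1) linear_rm(1)] by (simp add: o_def)

lemma asc_rm_quaternionic:
  assumes "quaternionic_pair p q"
  shows "asc p q (rm x p) = - asc p (omul p q) x"
proof -
  note Q = quaternionic_pairD[OF assms]
  have "asc p q (rm x p) = rm (rm (rm x p) p) q - rm (rm x p) (omul p q)" by (rule asc_right)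
  also have "\<dots> = - rm x q + rm (rm x (omul p q)) p"
  proof -
    have "rm (rm x (omul p q)) p = - rm (rm x p) (omul p q)"
      by (rule rm_anticommute) (simp add: Q)
    then show ?thesis by (simp add: rm_square Q)
  qed
  also have "\<dots> = - asc p (omul p q) x"
    unfolding asc_swap[of p "omul p q"] unfolding asc_right using Q by simp
  finally show ?thesis .
qed

lemma asc_lm_quaternionic:
  assumes "quaternionic_pair p q"
  shows "asc p q (lm p x) = asc p (omul p q) x"
proof -
  note Q = quaternionic_pairD[OF assms]
  have "lm q (lm p x) = - lm p (lm q x)" using lm_anticommute[of q p x] Q by simp
  moreover have "lm (omul p q) (lm p x) = - lm p (lm (omul p q) x)"
    using lm_anticommute[of "omul p q" p x] Q by simp
  ultimately show ?thesis unfolding asc_left using Q by (simp add: lm_square)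
qed

lemma lm_asc_quaternionic:
  assumes "quaternionic_pair p q"
  shows "lm p (asc p q x) = - asc p (omul p q) x"
  unfolding asc_left using quaternionic_pairD[OF assms] by (simp add: lm_square add_simps)

text \<open>This is the middle Moufang identity p (q x) p = (p q) (x p); the associators produced by
  the two rebracketings cancel.\<close>

lemma U_lm:
  assumes "quaternionic_pair p q"
  shows "U p (lm q x) = lm (omul p q) (rm x p)"
proof -
  have "U p (lm q x) = lm p (rm (lm q x) p)" by (simp add: U_def rm_lm_self)
  also have "rm (lm q x) p = lm q (rm x p) + asc p q x" by (simp add: asc_mid)
  also have "lm p (lm q (rm x p) + asc p q x) = lm p (lm q (rm x p)) - asc p (omul p q) x"
    by (simp add: add_simps lm_asc_quaternionic[OF assms])
  also have "lm p (lm q (rm x p)) = lm (omul p q) (rm x p) + asc p (omul p q) x"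
    by (simp add: lm_lm asc_rm_quaternionic[OF assms])
  finally show ?thesis by simp
qed

lemma commutator_U:
  assumes "quaternionic_pair p q"
  shows "lm q (U p x) - rm (U p x) q = - rm (lm (omul p q) x) p - lm p (rm x (omul p q))"
proof -
  have "lm q (U p x) = lm q (lm p (rm x p))" by (simp add: U_def rm_lm_self)
  also have "\<dots> = - lm (omul p q) (rm x p) + asc p q (rm x p)"
    using quaternionic_pairD[OF assms] by (simp add: lm_lm asc_swap[of p q])
  also have "\<dots> = - rm (lm (omul p q) x) p"
    unfolding asc_rm_quaternionic[OF assms] unfolding asc_mid by simp
  finally have 1: "lm q (U p x) = - rm (lm (omul p q) x) p" .
  have "rm (U p x) q = rm (lm p x) (omul p q) + asc p q (lm p x)"
    unfolding U_def by (rule rm_rm)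
  also have "\<dots> = lm p (rm x (omul p q))"
    unfolding asc_lm_quaternionic[OF assms] asc_swap[of p "omul p q"] unfolding asc_mid by simp
  finally show ?thesis using 1 by simp
qed

lemma quaternionic_pair_third:
  assumes "quaternionic_pair p q" shows "quaternionic_pair (omul p q) q"
  using quaternionic_pairD[OF assms] by (simp add: quaternionic_pair_def omul_linear)

text \<open>Applied to both remaining points p and \<open>omul p q\<close> of the line,
  \<open>commutator_U\<close> leaves four products. They pair up into two middle associators that
  differ by a sign.\<close>

lemma commutator_U_line:
  assumes "quaternionic_pair p q"
  shows "lm q (U p x + U (omul p q) x) - rm (U p x + U (omul p q) x) q = 2 *\<^sub>R asc (omul p q) p x"
proof -
  have "lm q (U (omul p q) x) - rm (U (omul p q) x) q = rm (lm p x) (omul p q) + lm (omul p q) (rm x p)"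
    using commutator_U[OF quaternionic_pair_third[OF assms], of x] quaternionic_pairD[OF assms] by simp
  then have "lm q (U p x + U (omul p q) x) - rm (U p x + U (omul p q) x) q
    = (rm (lm p x) (omul p q) - lm p (rm x (omul p q))) - (rm (lm (omul p q) x) p - lm (omul p q) (rm x p))"
    using commutator_U[OF assms, of x] by (simp add: add_simps algebra_simps)
  also have "\<dots> = asc (omul p q) p x - asc p (omul p q) x"
    by (simp only: asc_mid)
  finally show ?thesis by (simp add: asc_swap[of "omul p q" p] scaleR_2)
qed

lemma commutator_U_self:
  assumes "omul p p = - oe 0"
  shows "lm p (U p x) - rm (U p x) p = lm p x - rm x p"
proof -
  have "lm p (U p x) = - rm x p"
    using assms by (simp add: U_def rm_lm_self lm_square)
  moreover have "rm (U p x) p = - lm p x"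
    using assms by (simp add: U_def rm_square)
  ultimately show ?thesis by simp
qed

text \<open>The factor is 5 = 1 + 2 * 2: the sandwich by k gives the commutator once, and the three
  lines give twice the associator sum, which is two commutators by
  \<open>asc_pencil_sum\<close>.\<close>

lemma commutator_U_pencil:
  assumes "fano_pencil k p q r"
  defines "y \<equiv> \<lambda>x. U k x + U p x + U (omul p k) x + U q x + U (omul q k) x + U r x + U (omul r k) x"
  shows "lm k (y x) - rm (y x) k = 5 *\<^sub>R (lm k x - rm x k)"
proof -
  have Q: "quaternionic_pair p k" "quaternionic_pair q k" "quaternionic_pair r k"
    using assms(1)[unfolded fano_pencil_def] by blast+
  have "lm k (y x) - rm (y x) k = (lm k (U k x) - rm (U k x) k)
     + (lm k (U p x + U (omul p k) x) - rm (U p x + U (omul p k) x) k)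
     + (lm k (U q x + U (omul q k) x) - rm (U q x + U (omul q k) x) k)
     + (lm k (U r x + U (omul r k) x) - rm (U r x + U (omul r k) x) k)"
    unfolding y_def by (simp add: add_simps)
  also have "\<dots> = (lm k x - rm x k) + 2 *\<^sub>R (asc (omul p k) p x + asc (omul q k) q x + asc (omul r k) r x)"
    unfolding Q[THEN commutator_U_line] commutator_U_self[OF quaternionic_pairD(2)[OF Q(1)]]
    by (simp add: algebra_simps)
  also have "\<dots> = 5 *\<^sub>R (lm k x - rm x k)"
    unfolding asc_pencil_sum[OF assms(1)] using scaleR_left_distrib[of 1 4 "lm k x - rm x k"] by simp
  finally show ?thesis .
qed

lemma lm_U_lm_line:
  assumes "quaternionic_pair p k"
  shows "lm p (U k (lm p x)) + lm (omul p k) (U k (lm (omul p k) x))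
       = 2 *\<^sub>R (U k x - asc (omul p k) p (rm x k))"
proof -
  have gen: "lm p (U k (lm p x)) = U k x - asc (omul p k) p (rm x k)" if Q: "quaternionic_pair p k" for p
  proof -
    note D = quaternionic_pairD[OF Q]
    have "quaternionic_pair k p"
      using D by (simp add: quaternionic_pair_def omul_linear)
    then have "U k (lm p x) = - lm (omul p k) (rm x k)"
      using D by (simp add: U_lm)
    then have "lm p (U k (lm p x)) = - lm p (lm (omul p k) (rm x k))" by simp
    also have "\<dots> = lm k (rm x k) + asc p (omul p k) (rm x k)"
      using D by (simp add: lm_lm)
    finally show ?thesis by (simp add: U_def rm_lm_self asc_swap[of "omul p k" p])
  qed
  \<comment> \<open>For the pair \<open>omul p k\<close>, k the third point
    \<open>omul (omul p k) k\<close> is -p, so \<open>gen\<close> yields the same associator for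
    both points.\<close>
  have "asc (- p) (omul p k) y = asc (omul p k) p y" for y
    by (subst asc_swap) (simp add: asc_left omul_linear)
  then show ?thesis
    using gen[OF assms] gen[OF quaternionic_pair_third[OF assms]] quaternionic_pairD[OF assms]
    by (simp add: scaleR_2)
qed

text \<open>The associators from the three lines are taken at \<open>rm x k\<close>, where
  \<open>asc_pencil_sum\<close> evaluates them to 2 (k x k + x). The coefficients of
  \<open>U k x\<close> then add up to -1 + 6 - 4.\<close>

lemma lm_U_lm_pencil:
  assumes "fano_pencil k p q r"
  shows "lm k (U k (lm k x)) + lm p (U k (lm p x)) + lm (omul p k) (U k (lm (omul p k) x))
     + lm q (U k (lm q x)) + lm (omul q k) (U k (lm (omul q k) x))
     + lm r (U k (lm r x)) + lm (omul r k) (U k (lm (omul r k) x)) = U k x - 4 *\<^sub>R x"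
    (is "?l = _")
proof -
  have Q: "quaternionic_pair p k" "quaternionic_pair q k" "quaternionic_pair r k"
    using assms(1)[unfolded fano_pencil_def] by blast+
  have k: "omul k k = - oe 0" using quaternionic_pairD[OF Q(1)] by blast
  have "?l = lm k (U k (lm k x))
     + (lm p (U k (lm p x)) + lm (omul p k) (U k (lm (omul p k) x)))
     + (lm q (U k (lm q x)) + lm (omul q k) (U k (lm (omul q k) x)))
     + (lm r (U k (lm r x)) + lm (omul r k) (U k (lm (omul r k) x)))"
    by (simp only: add.assoc)
  also have "\<dots> = lm k (U k (lm k x)) + 6 *\<^sub>R U k x
      - 2 *\<^sub>R (asc (omul p k) p (rm x k) + asc (omul q k) q (rm x k) + asc (omul r k) r (rm x k))"
    unfolding Q[THEN lm_U_lm_line] by (simp add: algebra_simps flip: scaleR_left_distrib)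
  also have "\<dots> = - U k x + 6 *\<^sub>R U k x - 2 *\<^sub>R 2 *\<^sub>R (U k x + x)"
  proof -
    have "lm k (U k (lm k x)) = - U k x"
      using k by (simp add: U_def lm_square flip: rm_lm_self)
    moreover have "lm k (rm x k) - rm (rm x k) k = U k x + x"
      using k by (simp add: U_def rm_lm_self rm_square)
    ultimately show ?thesis
      unfolding asc_pencil_sum[OF assms(1)] by simp
  qed
  also have "\<dots> = (- 1 + 6 - 4) *\<^sub>R U k x - 4 *\<^sub>R x"
    by (simp only: scaleR_left_distrib scaleR_left_diff_distrib scaleR_add_right scaleR_scaleR) simp
  also have "\<dots> = U k x - 4 *\<^sub>R x" by simp
  finally show ?thesis .
qed

text \<open>A pencil lists each of the seven units once up to sign, and \<open>U\<close> does not
  see the sign.\<close>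

lemma commutator_U_sum:
  assumes "k \<in> {1..7}"
  shows "lm (oe k) (\<Sum>i\<in>{1..7}. U (oe i) x) - rm (\<Sum>i\<in>{1..7}. U (oe i) x) (oe k)
       = 5 *\<^sub>R (lm (oe k) x - rm x (oe k))"
proof -
  have "k = 1 \<or> k = 2 \<or> k = 3 \<or> k = 4 \<or> k = 5 \<or> k = 6 \<or> k = 7" using assms by auto
  then show ?thesis
    unfolding sum_atLeastAtMost_1_7
    by (elim disjE) (use fano_pencil_oe[THEN commutator_U_pencil, of x] in
      \<open>simp_all add: oe_mult_simps add_ac\<close>)
qed

lemma lm_U_lm_sum:
  assumes "k \<in> {1..7}"
  shows "(\<Sum>i\<in>{1..7}. lm (oe i) (U (oe k) (lm (oe i) x))) = U (oe k) x - 4 *\<^sub>R x"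
proof -
  have neg: "U p (- y) = - U p y" for p y by (rule linear_neg[OF linear_U])
  have "k = 1 \<or> k = 2 \<or> k = 3 \<or> k = 4 \<or> k = 5 \<or> k = 6 \<or> k = 7" using assms by auto
  then show ?thesis
    unfolding sum_atLeastAtMost_1_7
    by (elim disjE) (use fano_pencil_oe[THEN lm_U_lm_pencil, of x] in
      \<open>simp_all add: oe_mult_simps add_ac neg\<close>)
qed

section \<open>The real part and the reconstruction of an element from real parts\<close>

abbreviation re :: "'v \<Rightarrow> 'v" where
  "re \<equiv> oRe lm rm"

lemma re_eq: "re x = (5/12) *\<^sub>R x - (1/12) *\<^sub>R (\<Sum>i\<in>{1..7}. U (oe i) x)"
  by (simp add: oRe_def U_def)

lemma linear_re: "linear re"
  unfolding re_eq
  by (intro linear_compose_sub linear_compose_scale_right linear_compose_sum linear_id[unfolded id_def] ballI linear_U)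

text \<open>The weights 5/12 and 1/12 balance the factor 5 of \<open>commutator_U_sum\<close>, so
  \<open>re x\<close> commutes with every unit. Commutation alone then makes three times the
  associator vanish.\<close>

lemma re_in_ReV: "re x \<in> ReV lm rm"
proof -
  have "lm (oe k) (re x) = rm (re x) (oe k)" if k: "k < 8" for k
  proof (cases "k = 0")
    case False
    then have "k \<in> {1..7}" using k by auto
    then have "(1/12) *\<^sub>R (lm (oe k) (\<Sum>i\<in>{1..7}. U (oe i) x) - rm (\<Sum>i\<in>{1..7}. U (oe i) x) (oe k))
       = (5/12) *\<^sub>R (lm (oe k) x - rm x (oe k))"
      by (simp only: commutator_U_sum) simp
    then show ?thesis
      unfolding re_eq by (simp add: add_simps algebra_simps)
  qed simp
  then have "lm (\<Sum>i<8. (p $ oidx i) *\<^sub>R oe i) (re x) = rm (re x) (\<Sum>i<8. (p $ oidx i) *\<^sub>R oe i)" for p :: octo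
    by (simp add: sum_simps)
  then have c: "lm p (re x) = rm (re x) p" for p
    unfolding octo_expansion .
  \<comment> \<open>By commutation, the left, middle and right associators of \<open>re x\<close> form a telescoping sum.\<close>
  have "asc p q (re x) = 0" for p q
  proof -
    have "asc p q (re x) = rm (rm (re x) p) q - rm (re x) (omul p q)" by (rule asc_right)
    moreover have "asc p q (re x) = rm (re x) (omul p q) - lm p (rm (re x) q)"
      using asc_left[of p q "re x"] by (simp only: c)
    moreover have "asc p q (re x) = - (rm (lm p (re x)) q - lm p (rm (re x) q))"
      by (simp only: asc_mid[symmetric] asc_swap[of q p] minus_minus)
    then have "asc p q (re x) = lm p (rm (re x) q) - rm (rm (re x) p) q"
      by (simp add: c)
    ultimately have "asc p q (re x) + asc p q (re x) + asc p q (re x)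
      = (rm (rm (re x) p) q - rm (re x) (omul p q)) + (rm (re x) (omul p q) - lm p (rm (re x) q))
        + (lm p (rm (re x) q) - rm (rm (re x) p) q)"
      by metis
    then have "asc p q (re x) + asc p q (re x) + asc p q (re x) = 0" by simp
    then have "3 *\<^sub>R asc p q (re x) = 0"
      using scaleR_left_distrib[of 2 1 "asc p q (re x)"] by (simp add: scaleR_2)
    then show ?thesis by simp
  qed
  with c show ?thesis by (simp add: ReV_def)
qed

lemma re_expansion: "(\<Sum>i<8. lm (oe i) (re (lm (ocnj (oe i)) x))) = x"
proof -
  have neg: "re (- y) = - re y" for y by (rule linear_neg[OF linear_re])
  define u where "u = (\<Sum>k\<in>{1..7}. U (oe k) x)"
  have sq: "lm (oe i) (lm (oe i) x) = - x" if "i \<in> {1..7}" for i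
    using that by (simp add: lm_square omul_oe osgn_def)
  have "(\<Sum>i<8. lm (oe i) (re (lm (ocnj (oe i)) x))) = re x - (\<Sum>i\<in>{1..7}. lm (oe i) (re (lm (oe i) x)))"
    unfolding sum_lessThan_8 sum_atLeastAtMost_1_7 by (simp add: ocnj_oe neg)
  also have "(\<Sum>i\<in>{1..7}. lm (oe i) (re (lm (oe i) x)))
     = (5/12) *\<^sub>R (\<Sum>i\<in>{1..7}. lm (oe i) (lm (oe i) x))
       - (1/12) *\<^sub>R (\<Sum>i\<in>{1..7}. \<Sum>k\<in>{1..7}. lm (oe i) (U (oe k) (lm (oe i) x)))"
    unfolding re_eq by (simp only: add_simps scale_simps sum_simps sum_subtractf scaleR_sum_right)
  also have "(\<Sum>i\<in>{1..7}. lm (oe i) (lm (oe i) x)) = - 7 *\<^sub>R x"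
    using sq by (simp add: sum_negf sum_constant_scaleR)
  also have "(\<Sum>i\<in>{1..7}. \<Sum>k\<in>{1..7}. lm (oe i) (U (oe k) (lm (oe i) x)))
     = (\<Sum>k\<in>{1..7}. \<Sum>i\<in>{1..7}. lm (oe i) (U (oe k) (lm (oe i) x)))"
    \<comment> \<open>With the sum over the outer multiplications innermost,
      \<open>lm_U_lm_sum\<close> applies; its seven terms -4 x account for the 28.\<close>
    by (rule sum.swap)
  also have "\<dots> = u - 28 *\<^sub>R x"
    by (simp add: lm_U_lm_sum sum_subtractf sum_constant_scaleR u_def del: One_nat_def)
  finally have "(\<Sum>i<8. lm (oe i) (re (lm (ocnj (oe i)) x)))
     = re x - ((5/12) *\<^sub>R - 7 *\<^sub>R x - (1/12) *\<^sub>R (u - 28 *\<^sub>R x))" .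
  also have "\<dots> = (5/12 + 35/12 - 28/12) *\<^sub>R x"
    unfolding re_eq u_def[symmetric] scaleR_left_distrib scaleR_left_diff_distrib
    by (simp add: scaleR_diff_right)
  finally show ?thesis by simp
qed

section \<open>Coordinates, extension and lifting\<close>

lemma ReV_commute: "m \<in> ReV lm rm \<Longrightarrow> rm m p = lm p m"
  and ReV_asc: "m \<in> ReV lm rm \<Longrightarrow> asc p q m = 0"
  by (simp_all add: ReV_def)

lemma lm_lm_ReV: "m \<in> ReV lm rm \<Longrightarrow> lm p (lm q m) = lm (omul p q) m"
  by (simp add: lm_lm ReV_asc)

lemma rm_lm_ReV: "m \<in> ReV lm rm \<Longrightarrow> rm (lm p m) q = lm (omul p q) m"
  by (simp add: rm_rm ReV_asc flip: ReV_commute)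

lemma re_ReV: "m \<in> ReV lm rm \<Longrightarrow> re m = m"
proof -
  assume m: "m \<in> ReV lm rm"
  have "U (oe i) m = - m" if "i \<in> {1..7}" for i
    using that m by (simp add: U_def rm_lm_ReV omul_oe osgn_def)
  then have "re m = (5/12) *\<^sub>R m - (1/12) *\<^sub>R (- 7 *\<^sub>R m)"
    by (simp add: re_eq sum_negf sum_constant_scaleR del: One_nat_def)
  also have "\<dots> = (5/12 + 7/12) *\<^sub>R m"
    unfolding scaleR_left_distrib by simp
  finally show ?thesis by simp
qed

text \<open>For k > 0, the sandwich of \<open>oe k\<close> by itself gives -\<open>oe k\<close> and
  by each of the six other units \<open>oe k\<close>. The total 5 makes the two terms of
  \<open>re\<close> cancel.\<close>

lemma re_lm_ReV:
  assumes m: "m \<in> ReV lm rm"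
  shows "re (lm p m) = (p $ oidx 0) *\<^sub>R m"
proof -
  have five: "5 *\<^sub>R y = y + (y + (y + (y + y)))" for y :: 'v
    using scaleR_left_distrib[of 1 4 y] scaleR_left_distrib[of 2 2 y] by (simp add: scaleR_2)
  have oe: "re (lm (oe k) m) = (oe k $ oidx 0) *\<^sub>R m" if k: "k < 8" for k
  proof (cases "k = 0")
    case True
    then show ?thesis using m by (simp add: re_ReV oe_nth)
  next
    case False
    then have "k \<in> {1..7}" using k by auto
    then have "k = 1 \<or> k = 2 \<or> k = 3 \<or> k = 4 \<or> k = 5 \<or> k = 6 \<or> k = 7" by auto
    then have "(\<Sum>i\<in>{1..7}. U (oe i) (lm (oe k) m)) = 5 *\<^sub>R lm (oe k) m"
      unfolding sum_atLeastAtMost_1_7 U_def lm_lm_ReV[OF m] rm_lm_ReV[OF m]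
      by (elim disjE) (simp_all add: oe_mult_simps five)
    then show ?thesis using k False by (simp add: re_eq oe_nth)
  qed
  have "re (lm (\<Sum>k<8. (p $ oidx k) *\<^sub>R oe k) m) = ((\<Sum>k<8. (p $ oidx k) *\<^sub>R oe k) $ oidx 0) *\<^sub>R m"
    by (simp add: sum_simps linear_sum[OF linear_re] linear_scale[OF linear_re] oe scaleR_sum_left)
  then show ?thesis unfolding octo_expansion .
qed

section \<open>Identities for the real part, tested on octonion multiples of real elements\<close>

lemma linear_eqI:
  assumes "linear f" "linear g" "\<And>p m. m \<in> ReV lm rm \<Longrightarrow> f (lm p m) = g (lm p m)"
  shows "f x = g x"
proof -
  have "f (\<Sum>i<8. lm (oe i) (re (lm (ocnj (oe i)) x))) = g (\<Sum>i<8. lm (oe i) (re (lm (ocnj (oe i)) x)))"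
    unfolding linear_sum[OF assms(1)] linear_sum[OF assms(2)] using assms(3) re_in_ReV by simp
  then show ?thesis unfolding re_expansion .
qed

lemmas linear_o = linear_compose[unfolded o_def]

lemma re_lm_commute: "re (lm p x) = re (rm x p)"
proof (rule linear_eqI[of "\<lambda>x. re (lm p x)" "\<lambda>x. re (rm x p)"])
  show "linear (\<lambda>x. re (lm p x))" "linear (\<lambda>x. re (rm x p))"
    using linear_o[OF linear_lm(1) linear_re] linear_o[OF linear_rm(1) linear_re] by auto
qed (simp add: lm_lm_ReV rm_lm_ReV re_lm_ReV omul_trace_commute[of p])

text \<open>On \<open>lm p m\<close> with m real, \<open>re\<close> is the octonion trace times m,
  and the trace kills associators.\<close>

lemma re_rm_rm: "re (rm (rm x p) q) = re (rm x (omul p q))"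
proof (rule linear_eqI[of "\<lambda>x. re (rm (rm x p) q)" "\<lambda>x. re (rm x (omul p q))"])
  show "linear (\<lambda>x. re (rm (rm x p) q))" "linear (\<lambda>x. re (rm x (omul p q)))"
    using linear_o[OF linear_o[OF linear_rm(1) linear_rm(1)] linear_re] linear_o[OF linear_rm(1) linear_re] by auto
qed (simp add: rm_lm_ReV re_lm_ReV omul_trace_assoc)

lemma re_rm_lm: "re (rm (lm p x) q) = re (rm x (omul q p))"
proof (rule linear_eqI[of "\<lambda>x. re (rm (lm p x) q)" "\<lambda>x. re (rm x (omul q p))"])
  show "linear (\<lambda>x. re (rm (lm p x) q))" "linear (\<lambda>x. re (rm x (omul q p)))"
    using linear_o[OF linear_o[OF linear_lm(1) linear_rm(1)] linear_re] linear_o[OF linear_rm(1) linear_re] by auto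
  fix r m assume m: "m \<in> ReV lm rm"
  have "omul (omul p r) q $ oidx 0 = omul r (omul q p) $ oidx 0"
    by (metis omul_trace_assoc omul_trace_commute)
  then show "re (rm (lm p (lm r m)) q) = re (rm (lm r m) (omul q p))"
    using m by (simp add: lm_lm_ReV rm_lm_ReV re_lm_ReV)
qed

text \<open>The coordinates of y in \<open>re_expansion\<close> are among the tested elements, once
  the conjugate units are moved to the right.\<close>

lemma eq_0_if_re_rm_eq_0:
  assumes "\<And>q. re (rm y q) = 0" shows "y = 0"
  using re_expansion[of y] by (simp add: re_lm_commute assms)

text \<open>This discharges the definite description: \<open>re_expansion\<close> gives existence,
  and applying \<open>re\<close> after multiplication by a conjugate unit recovers each coefficient
  of any expansion.\<close>

lemma ocoords_eq: "ocoords lm rm x = (\<lambda>i. if i < 8 then re (lm (ocnj (oe i)) x) else 0)"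
  unfolding ocoords_def
proof (rule the_equality)
  show "(\<forall>i<8. (if i < 8 then re (lm (ocnj (oe i)) x) else 0) \<in> ReV lm rm) \<and>
    (\<forall>i\<ge>8. (if i < 8 then re (lm (ocnj (oe i)) x) else 0) = 0) \<and>
    x = (\<Sum>i<8. lm (oe i) (if i < 8 then re (lm (ocnj (oe i)) x) else 0))"
    using re_in_ReV re_expansion[of x] by simp
next
  fix xs assume xs: "(\<forall>i<8. xs i \<in> ReV lm rm) \<and> (\<forall>i\<ge>8. xs i = 0) \<and> x = (\<Sum>i<8. lm (oe i) (xs i))"
  have "re (lm (ocnj (oe i)) x) = xs i" if i: "i < 8" for i
  proof -
    have "re (lm (ocnj (oe i)) x) = (\<Sum>j<8. re (lm (ocnj (oe i)) (lm (oe j) (xs j))))"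
      using xs by (simp add: sum_simps linear_sum[OF linear_re])
    also have "\<dots> = (\<Sum>j<8. if i = j then xs j else 0)"
      using xs i by (intro sum.cong) (auto simp: lm_lm_ReV re_lm_ReV omul_ocnj_oe_trace oe_nth)
    also have "\<dots> = xs i" using i by simp
    finally show ?thesis .
  qed
  then show "xs = (\<lambda>i. if i < 8 then re (lm (ocnj (oe i)) x) else 0)"
    using xs by auto
qed

lemma oext_eq: "oext lm rm h x = (\<Sum>i<8. rm (h (re (lm (ocnj (oe i)) x))) (oe i))"
  by (simp add: oext_def ocoords_eq)

lemma linear_oext: assumes "linear h" shows "linear (oext lm rm h)"
  unfolding oext_eq
  by (intro linear_compose_sum ballI linear_o[OF linear_o[OF linear_o[OF linear_lm(1) linear_re] assms] linear_rm(1)])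

text \<open>The coordinates of \<open>lm p m\<close> are real multiples of m, so linearity of h lets
  p be reassembled from its own coordinates.\<close>

lemma oext_lm_ReV:
  assumes h: "linear h" and m: "m \<in> ReV lm rm"
  shows "oext lm rm h (lm p m) = rm (h m) p"
proof -
  have "oext lm rm h (lm p m) = rm (h m) (\<Sum>i<8. (p $ oidx i) *\<^sub>R oe i)"
    unfolding oext_eq
    by (simp add: lm_lm_ReV[OF m] re_lm_ReV[OF m] omul_ocnj_oe_trace linear_scale[OF h] sum_simps)
  then show ?thesis unfolding octo_expansion .
qed

text \<open>Para-linearity only gives equality of real parts. Since m associates with octonions, the
  difference still has zero real part after right multiplication by any q, hence vanishes.\<close>

lemma right_para_linear_rm_ReV:
  assumes f: "right_para_linear lm rm f" and m: "m \<in> ReV lm rm"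
  shows "f (rm m p) = rm (f m) p"
proof -
  have f': "re (rm (f x) p) = re (f (rm x p))" for x p
    using f by (simp add: right_para_linear_def oB_def linear_diff[OF linear_re])
  have "re (rm (rm (f m) p - f (rm m p)) q) = 0" for q
  proof -
    have "rm (rm m p) q = rm m (omul p q)"
      by (simp add: rm_rm ReV_asc[OF m])
    then show ?thesis
      by (simp add: add_simps linear_diff[OF linear_re] re_rm_rm f')
  qed
  then show ?thesis using eq_0_if_re_rm_eq_0 by (metis eq_iff_diff_eq_0)
qed

text \<open>This pairing characterises the lifting and replaces its defining sum in all later
  computations.\<close>

lemma re_rm_olif:
  assumes h: "linear h" and r: "\<And>x. h x \<in> ReV lm rm"
  shows "re (rm (olif rm h x) c) = h (rm x c)"
proof -
  have "re (rm (olif rm h x) c) = (\<Sum>i<8. re (rm (lm (oe i) (h (rm x (ocnj (oe i))))) c))"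
    by (simp add: olif_def sum_simps linear_sum[OF linear_re] ReV_commute[OF r])
  also have "\<dots> = (\<Sum>i<8. (omul (oe i) c $ oidx 0) *\<^sub>R h (rm x (ocnj (oe i))))"
    by (simp add: rm_lm_ReV[OF r] re_lm_ReV[OF r])
  also have "\<dots> = h (rm x (\<Sum>i<8. (omul (oe i) c $ oidx 0) *\<^sub>R ocnj (oe i)))"
    by (simp add: sum_simps linear_sum[OF h] linear_scale[OF h])
  finally show ?thesis unfolding ocnj_expansion .
qed

lemma linear_olif: "linear h \<Longrightarrow> linear (olif rm h)"
  unfolding olif_def
  by (intro linear_compose_sum ballI linear_o[OF linear_o[OF linear_rm(1)] linear_rm(1)])

text \<open>Linearised right alternative law, in the shape produced by the left action on an
  operator.\<close>

lemma rm_rm_swap: "rm x (omul c p) + rm x (omul p c) - rm (rm x p) c = rm (rm x c) p"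
  by (simp add: rm_rm asc_swap[of c p])

lemma asc_oCJ:
  assumes "p \<in> oCJ J" "q \<in> oCJ J" shows "asc p q x = 0"
proof -
  have JJ: "lm (omul J J) x = lm J (lm J x)" by (simp add: lm_square)
  obtain a b c d where "p = cj J a b" "q = cj J c d" using assms unfolding oCJ_iff by blast
  then show ?thesis
    by (simp add: asc_left cj_def omul_linear add_simps JJ algebra_simps)
qed

lemma rm_rm_oCJ:
  assumes "p \<in> oCJ J" "q \<in> oCJ J" shows "rm (rm x p) q = rm x (omul p q)"
  using asc_oCJ[OF assms] by (simp add: rm_rm)

end

section \<open>The resolvent series\<close>

locale banach_octonion_bimodule =
  fixes lm :: "octo \<Rightarrow> 'v::banach \<Rightarrow> 'v" and rm :: "'v \<Rightarrow> octo \<Rightarrow> 'v"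
  assumes banach: "banach_obimodule lm rm"

sublocale banach_octonion_bimodule \<subseteq> octonion_bimodule
  using banach by unfold_locales (simp add: banach_obimodule_def)

context banach_octonion_bimodule
begin

lemma norm_lm: "norm (lm p x) = norm p * norm x"
  and norm_rm: "norm (rm x p) = norm p * norm x"
  using banach by (simp_all add: banach_obimodule_def)

lemma bounded_linear_lm: "bounded_linear (lm p)"
  by (rule bounded_linear_intro[of _ "norm p"]) (simp_all add: add_simps norm_lm mult.commute)

lemma bounded_linear_rm: "bounded_linear (\<lambda>x. rm x p)"
  by (rule bounded_linear_intro[of _ "norm p"]) (simp_all add: add_simps norm_rm mult.commute)

lemma bounded_linear_re: "bounded_linear re"
proof -
  have "bounded_linear (\<lambda>x. U p x)" for p
    unfolding U_def by (rule bounded_linear_compose[OF bounded_linear_rm bounded_linear_lm])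
  then show ?thesis
    unfolding re_eq by (intro bounded_linear_sub bounded_linear_scaleR_right bounded_linear_compose[OF bounded_linear_scaleR_right]
       bounded_linear_sum bounded_linear_ident)
qed

lemma summable_power_bound:
  fixes f :: "nat \<Rightarrow> 'v" and t s :: real
  assumes "0 \<le> t" "t < s" and f: "\<And>n. norm (f n) \<le> K * t ^ n * inverse s ^ Suc n"
  shows "summable f"
proof (rule summable_comparison_test')
  show "summable (\<lambda>n. (K * inverse s) * (t / s) ^ n)"
    using assms by (intro summable_mult summable_geometric) simp
  show "norm (f n) \<le> (K * inverse s) * (t / s) ^ n" for n
    using f[of n] by (simp add: power_mult_distrib power_inverse divide_inverse mult_ac)
qed

lemma norm_funpow_le:
  fixes T :: "'v \<Rightarrow> 'v"
  assumes "bounded_linear T"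
  shows "norm ((T ^^ n) x) \<le> onorm T ^ n * norm x"
proof (induction n)
  case (Suc n)
  have "norm (T ((T ^^ n) x)) \<le> onorm T * norm ((T ^^ n) x)"
    by (rule onorm[OF assms])
  also have "\<dots> \<le> onorm T * (onorm T ^ n * norm x)"
    by (rule mult_left_mono[OF Suc onorm_pos_le[OF assms]])
  finally show ?case by (simp add: mult.assoc)
qed simp

lemma linear_funpow:
  fixes T :: "'v \<Rightarrow> 'v"
  assumes "linear T" shows "linear (T ^^ n)"
  by (induction n) (simp_all only: funpow.simps linear_compose[OF _ assms] linear_id)

section \<open>The right series on \<open>oCJV\<close>\<close>

lemma oext_ReV: "linear h \<Longrightarrow> m \<in> ReV lm rm \<Longrightarrow> oext lm rm h m = h m"
  using oext_lm_ReV[of h m "oe 0"] by simp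

lemma oext_rm_oCJV:
  assumes h: "linear h" and a: "a \<in> ReV lm rm" and b: "b \<in> ReV lm rm" and q: "q \<in> oCJ J"
  shows "oext lm rm h (rm (a + lm J b) q) = rm (h a + rm (h b) J) q"
proof -
  have "rm (a + lm J b) q = lm q a + lm (omul J q) b"
    by (simp add: add_simps ReV_commute[OF a] rm_lm_ReV[OF b])
  then show ?thesis
    by (simp add: linear_add[OF linear_oext[OF h]] oext_lm_ReV[OF h] a b add_simps
        rm_rm_oCJ[OF oCJ_basic(2) q])
qed

text \<open>Left and right multiplication by q agree on this element, and the extension commutes
  with the latter. Of the three terms of the right action only one survives.\<close>

lemma oract_oext_oCJV:
  assumes J: "J \<in> oS" and h: "linear h" and a: "a \<in> ReV lm rm" and b: "b \<in> ReV lm rm" and q: "q \<in> oCJ J"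
  shows "oract lm rm (oext lm rm h) q (a + lm J b) = rm (h a + rm (h b) J) q"
proof -
  have "lm q (a + lm J b) = rm (a + lm J b) q"
    by (simp add: add_simps ReV_commute[OF a] rm_lm_ReV[OF b] lm_lm_ReV[OF b]
        oCJ_commute[OF J q oCJ_basic(2)])
  moreover have "oext lm rm h (a + lm J b) = h a + rm (h b) J"
    using oext_rm_oCJV[OF h a b oCJ_basic(1)] by simp
  ultimately show ?thesis
    by (simp add: oract_def oB_def oext_rm_oCJV[OF h a b q])
qed

lemma bounded_linear_suminf_eq:
  assumes "bounded_linear f" "summable u"
  shows "f (suminf u) = (\<Sum>n. f (u n))" "summable (\<lambda>n. f (u n))"
  using bounded_linear.suminf[OF assms] bounded_linear.summable[OF assms] by auto

lemma right_resolvent_series: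
  assumes T: "bounded_linear T" and J: "J \<in> oS" and s: "s \<in> oCJ J" and ns: "onorm T < norm s"
    and x: "x \<in> oCJV lm rm J"
  defines "t \<equiv> \<lambda>n. oract lm rm (orpow lm rm T n) (opow (oinv s) (Suc n)) x"
    and "d \<equiv> \<lambda>n. oassoc lm rm T (orpow lm rm T n) (rm x (opow (oinv s) (Suc n)))"
  shows "summable t" "summable d" "oR rm s (suminf t) - T (suminf t) = x + suminf d"
proof -
  obtain a b where a: "a \<in> ReV lm rm" and b: "b \<in> ReV lm rm" and xab: "x = a + lm J b"
    using x unfolding oCJV_def by blast
  define w where "w n = opow (oinv s) (Suc n)" for n
  define A where "A n = (T ^^ n) a + rm ((T ^^ n) b) J" for n
  have lT: "linear T" and lTn: "linear (T ^^ n)" for n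
    using linear_funpow bounded_linear.linear[OF T] by auto
  have s0: "s \<noteq> 0" using ns onorm_pos_le[OF T] by auto
  have w: "w n \<in> oCJ J" for n
    unfolding w_def by (intro opow_oCJ oinv_oCJ J s)
  \<comment> \<open>Here \<open>w n\<close> is the power of exponent -1-n, so a factor s shifts the
    index down and turns \<open>w 0\<close> into 1.\<close>
  have sw: "omul (w (Suc n)) s = w n" "omul (w 0) s = oe 0" for n
    unfolding oCJ_commute[OF J w s] unfolding w_def omul_opow_oinv[OF J s s0] by simp_all
  have nw: "norm (w n) = inverse (norm s) ^ Suc n" for n
    unfolding w_def by (simp only: norm_opow[OF J oinv_oCJ[OF J s]] norm_oinv)
  have t: "t n = rm (A n) (w n)" for n
    unfolding t_def orpow_def xab w_def[symmetric] A_def by (rule oract_oext_oCJV[OF J lTn a b w])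
  have nA: "norm (A n) \<le> (norm a + norm b) * onorm T ^ n" for n
  proof -
    have "norm (A n) \<le> norm ((T ^^ n) a) + norm ((T ^^ n) b)"
      unfolding A_def using norm_triangle_ineq[of "(T ^^ n) a" "rm ((T ^^ n) b) J"]
      by (simp add: norm_rm oS_imaginary_unit[OF J])
    then show ?thesis
      using norm_funpow_le[OF T, of n a] norm_funpow_le[OF T, of n b] by (simp add: algebra_simps)
  qed
  show st: "summable t"
  proof (rule summable_power_bound[OF onorm_pos_le[OF T] ns])
    show "norm (t n) \<le> (norm a + norm b) * onorm T ^ n * inverse (norm s) ^ Suc n" for n
      unfolding t norm_rm nw using mult_right_mono[OF nA, of "inverse (norm s) ^ Suc n" n]
      by (simp only: mult.commute zero_le_power inverse_nonnegative_iff_nonnegative norm_ge_zero)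
  qed
  have ts: "rm (t (Suc n)) s = rm (A (Suc n)) (w n)" for n
    unfolding t rm_rm_oCJ[OF w s] sw ..
  have d: "d n = rm (t (Suc n)) s - T (t n)" for n
  proof -
    have 1: "linear (T \<circ> oext lm rm (T ^^ n))"
      by (rule linear_compose[OF linear_oext[OF lTn] lT])
    have "oext lm rm (T ^^ n) (rm x (w n)) = t n"
      unfolding xab t A_def by (rule oext_rm_oCJV[OF lTn a b w])
    \<comment> \<open>On real elements the regular composition with T is ordinary composition: the
      power of T rises to n+1 while the weight stays \<open>w n\<close>.\<close>
    moreover have "oext lm rm (T \<circ> oext lm rm (T ^^ n)) (rm x (w n)) = rm (A (Suc n)) (w n)"
      unfolding xab oext_rm_oCJV[OF 1 a b w]
      by (simp add: oext_ReV[OF lTn] a b A_def)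
    ultimately show ?thesis
      unfolding d_def oassoc_def ocomp_def orpow_def w_def[symmetric] ts by simp
  qed
  note rs = bounded_linear_suminf_eq[OF bounded_linear_rm st, of s]
  note Ts = bounded_linear_suminf_eq[OF T st]
  have rs': "summable (\<lambda>n. rm (t (Suc n)) s)" using rs(2) by (subst summable_Suc_iff)
  show "summable d"
    unfolding d by (rule summable_diff[OF rs' Ts(2)])
  \<comment> \<open>The head of the series multiplied by s is x; its tail is the first half of
    \<open>d\<close>.\<close>
  have "rm (t 0) s = x"
    unfolding t rm_rm_oCJ[OF w s] sw xab A_def by (simp add: ReV_commute[OF b])
  moreover have "(\<Sum>n. rm (t n) s) = rm (t 0) s + (\<Sum>n. rm (t (Suc n)) s)"
    using suminf_split_head[OF rs(2)] by simp
  moreover have "suminf d = (\<Sum>n. rm (t (Suc n)) s) - (\<Sum>n. T (t n))"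
    unfolding d by (rule suminf_diff[OF rs' Ts(2), symmetric])
  ultimately show "oR rm s (suminf t) - T (suminf t) = x + suminf d"
    unfolding oR_def rs(1) Ts(1) by simp
qed

section \<open>The left series after projection to \<open>oCJV\<close>\<close>

lemma opi_eqI:
  assumes "re v = re w" "re (rm v (ocnj J)) = re (rm w (ocnj J))"
  shows "opi lm rm J v = opi lm rm J w"
  using assms by (simp add: opi_def re_lm_commute)

lemma norm_sum_8_le:
  fixes f :: "nat \<Rightarrow> 'v"
  assumes "\<And>i. norm (f i) \<le> K" shows "norm (\<Sum>i<8. f i) \<le> 8 * K"
  using sum_norm_le[of "{..<8}" f "\<lambda>_. K"] assms by simp

lemma left_resolvent_series:
  assumes T: "T \<in> BRO lm rm" and J: "J \<in> oS" and s: "s \<in> oCJ J" and ns: "onorm T < norm s"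
  defines "t \<equiv> \<lambda>y n. olact lm rm (opow (oinv s) (Suc n)) (olpow lm rm T n) y"
    and "d \<equiv> \<lambda>x n. rm (oassoc lm rm (olpow lm rm T n) T x) (opow (oinv s) (Suc n))"
  shows "summable (t y)" "summable (d x)"
    "opi lm rm J (suminf (t (oR rm s x - T x))) = opi lm rm J x + opi lm rm J (suminf (d x))"
proof -
  have bT: "bounded_linear T" and pT: "right_para_linear lm rm T"
    using T by (simp_all add: BRO_def)
  have lT: "linear T" and lTn: "linear (T ^^ n)" for n
    using linear_funpow bounded_linear.linear[OF bT] by auto
  have s0: "s \<noteq> 0" using ns onorm_pos_le[OF bT] by auto
  define w where "w n = opow (oinv s) (Suc n)" for n
  have w: "w n \<in> oCJ J" for n
    unfolding w_def by (intro opow_oCJ oinv_oCJ J s)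
  have nw: "norm (w n) = inverse (norm s) ^ Suc n" for n
    unfolding w_def by (simp only: norm_opow[OF J oinv_oCJ[OF J s]] norm_oinv)
  define g where "g = olpow lm rm T"
  have lre: "linear (re \<circ> (T ^^ n))" for n
    by (rule linear_compose[OF lTn linear_re])
  have lg: "linear (g n)" for n
    unfolding g_def olpow_def by (rule linear_olif[OF lre])
  have re_g: "re (rm (g n y) c) = re ((T ^^ n) (rm y c))" for n y c
    unfolding g_def olpow_def using re_rm_olif[OF lre] re_in_ReV by simp
  \<comment> \<open>Tested on \<open>lm p m\<close>, this is where para-linearity enters: the
    octonion factor moves inside T on the real element m, which produces the power n+1.\<close>
  have re_oext: "re (rm (oext lm rm (g n \<circ> T) x) c) = re ((T ^^ Suc n) (rm x c))" for n x c
  proof (rule linear_eqI[of "\<lambda>x. re (rm (oext lm rm (g n \<circ> T) x) c)" "\<lambda>x. re ((T ^^ Suc n) (rm x c))"])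
    have lgT: "linear (g n \<circ> T)" by (rule linear_compose[OF lT lg])
    show "linear (\<lambda>x. re (rm (oext lm rm (g n \<circ> T) x) c))"
      by (rule linear_o[OF linear_o[OF linear_oext[OF lgT] linear_rm(1)] linear_re])
    show "linear (\<lambda>x. re ((T ^^ Suc n) (rm x c)))"
      by (rule linear_o[OF linear_o[OF linear_rm(1) lTn] linear_re])
    fix p m assume m: "m \<in> ReV lm rm"
    have "re (rm (oext lm rm (g n \<circ> T) (lm p m)) c) = re (rm (g n (T m)) (omul p c))"
      by (simp add: oext_lm_ReV[OF lgT m] re_rm_rm)
    also have "\<dots> = re ((T ^^ n) (T (rm m (omul p c))))"
      by (simp add: re_g right_para_linear_rm_ReV[OF pT m])
    also have "rm m (omul p c) = rm (lm p m) c"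
      by (simp add: ReV_commute[OF m] rm_lm_ReV[OF m])
    finally show "re (rm (oext lm rm (g n \<circ> T) (lm p m)) c) = re ((T ^^ Suc n) (rm (lm p m) c))"
      by (simp only: funpow_Suc_right comp_apply[of "T ^^ n" T])
  qed
  \<comment> \<open>The left action contributes three terms; the pairing collects them under a
    single power of T, where \<open>rm_rm_swap\<close> merges them.\<close>
  have re_t: "re (rm (t y n) c) = re ((T ^^ n) (rm (rm y c) (w n)))" for y n c
  proof -
    have "re (rm (t y n) c) = re (rm (g n y) (omul c (w n))) + re (rm (g n y) (omul (w n) c)) - re (rm (g n (rm y (w n))) c)"
      unfolding t_def olact_def oB_def g_def[symmetric] w_def[symmetric]
      by (simp add: add_simps linear_add[OF linear_re] linear_diff[OF linear_re] re_rm_lm re_rm_rm)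
    also have "\<dots> = re ((T ^^ n) (rm y (omul c (w n)) + rm y (omul (w n) c) - rm (rm y (w n)) c))"
      by (simp add: re_g linear_add[OF linear_re] linear_diff[OF linear_re] linear_add[OF lTn] linear_diff[OF lTn])
    finally show ?thesis unfolding rm_rm_swap .
  qed
  obtain k where k: "norm (re x) \<le> norm x * k" "k > 0" for x
    using bounded_linear.pos_bounded[OF bounded_linear_re] by metis
  have ng: "norm (g n y) \<le> 8 * (onorm T ^ n * norm y * k)" for n y
    unfolding g_def olpow_def olif_def
  proof (rule norm_sum_8_le)
    fix i
    have "norm (re ((T ^^ n) (rm y (ocnj (oe i))))) \<le> norm ((T ^^ n) (rm y (ocnj (oe i)))) * k"
      by (rule k)
    also have "\<dots> \<le> onorm T ^ n * norm y * k"
      using norm_funpow_le[OF bT, of n "rm y (ocnj (oe i))"] k(2)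
      by (simp add: norm_rm norm_ocnj norm_oe)
    finally show "norm (rm ((re \<circ> T ^^ n) (rm y (ocnj (oe i)))) (oe i)) \<le> onorm T ^ n * norm y * k"
      by (simp add: norm_rm norm_oe)
  qed
  show st: "summable (t y)" for y
  proof (rule summable_power_bound[OF onorm_pos_le[OF bT] ns])
    fix n
    have "norm (t y n) \<le> norm (lm (w n) (g n y)) + (norm (rm (g n y) (w n)) + norm (g n (rm y (w n))))"
      unfolding t_def olact_def oB_def g_def[symmetric] w_def[symmetric]
      by (intro order_trans[OF norm_triangle_ineq] add_left_mono norm_triangle_ineq4)
    also have "\<dots> = norm (w n) * norm (g n y) + norm (w n) * norm (g n y) + norm (g n (rm y (w n)))"
      by (simp add: norm_lm norm_rm)
    also have "\<dots> \<le> norm (w n) * (8 * (onorm T ^ n * norm y * k)) + norm (w n) * (8 * (onorm T ^ n * norm y * k))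
        + 8 * (onorm T ^ n * norm (rm y (w n)) * k)"
      by (intro add_mono mult_left_mono ng norm_ge_zero)
    also have "\<dots> = (24 * norm y * k) * onorm T ^ n * inverse (norm s) ^ Suc n"
      unfolding nw[symmetric] by (simp add: norm_rm)
    finally show "norm (t y n) \<le> (24 * norm y * k) * onorm T ^ n * inverse (norm s) ^ Suc n" .
  qed
  show sd: "summable (d x)" for x
  proof (rule summable_power_bound[OF onorm_pos_le[OF bT] ns])
    fix n
    \<comment> \<open>One factor 8 counts the summands of the extension, the other those of the
      lifting.\<close>
    have "norm (oext lm rm (g n \<circ> T) x) \<le> 8 * (8 * (onorm T ^ n * (onorm T * (norm x * k)) * k))"
      unfolding oext_eq
    proof (rule norm_sum_8_le)
      fix i
      have "norm (T (re (lm (ocnj (oe i)) x))) \<le> onorm T * norm (re (lm (ocnj (oe i)) x))"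
        by (rule onorm[OF bT])
      also have "\<dots> \<le> onorm T * (norm x * k)"
        using k(1)[of "lm (ocnj (oe i)) x"] onorm_pos_le[OF bT]
        by (intro mult_left_mono) (simp_all add: norm_lm norm_ocnj norm_oe)
      finally have "8 * (onorm T ^ n * norm (T (re (lm (ocnj (oe i)) x))) * k) \<le> 8 * (onorm T ^ n * (onorm T * (norm x * k)) * k)"
        using k(2) onorm_pos_le[OF bT] by (intro mult_left_mono mult_right_mono) auto
      then show "norm (rm ((g n \<circ> T) (re (lm (ocnj (oe i)) x))) (oe i)) \<le> 8 * (onorm T ^ n * (onorm T * (norm x * k)) * k)"
        using ng[of n "T (re (lm (ocnj (oe i)) x))"] by (simp add: norm_rm norm_oe)
    qed
    then have "norm (oassoc lm rm (g n) T x) \<le> (64 * (onorm T * norm x * k * k) + 8 * (norm (T x) * k)) * onorm T ^ n"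
      unfolding oassoc_def ocomp_def using ng[of n "T x"]
        norm_triangle_ineq4[of "oext lm rm (g n \<circ> T) x" "g n (T x)"]
      by (simp add: algebra_simps)
    from mult_right_mono[OF this norm_ge_zero[of "w n"]]
    show "norm (d x n) \<le> (64 * (onorm T * norm x * k * k) + 8 * (norm (T x) * k)) * onorm T ^ n * inverse (norm s) ^ Suc n"
      unfolding d_def g_def[symmetric] w_def[symmetric] norm_rm nw[symmetric] by (simp only: mult.commute)
  qed
  have re_sums: "re (rm (suminf (t (oR rm s x - T x))) c) = re (rm (x + suminf (d x)) c)" if c: "c \<in> oCJ J" for c
  proof -
    have bl: "bounded_linear (\<lambda>v. re (rm v c))"
      by (rule bounded_linear_compose[OF bounded_linear_re bounded_linear_rm])
    \<comment> \<open>The exponent here is -n rather than -1-n, because the factor s of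
      \<open>oR rm s x\<close> cancels one inverse.\<close>
    define \<phi> where "\<phi> n = re ((T ^^ n) (rm x (omul c (opow (oinv s) n))))" for n
    define \<psi> where "\<psi> n = re ((T ^^ n) (rm (T x) (omul c (w n))))" for n
    have cs: "omul (omul s c) (w n) = omul c (opow (oinv s) n)" for n
      using oCJ_assoc[OF J c s w, of n] oCJ_commute[OF J s c] omul_opow_oinv[OF J s s0, of n]
      unfolding w_def by simp
    have 1: "re (rm (t (oR rm s x - T x) n) c) = \<phi> n - \<psi> n" for n
    proof -
      have "rm (rm (oR rm s x - T x) c) (w n) = rm x (omul c (opow (oinv s) n)) - rm (T x) (omul c (w n))"
        by (simp add: oR_def add_simps rm_rm_oCJ[OF s c] rm_rm_oCJ[OF c w] rm_rm_oCJ[OF oCJ_omul[OF J s c] w] cs)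
      then show ?thesis
        by (simp add: re_t \<phi>_def \<psi>_def linear_diff[OF linear_re] linear_diff[OF lTn])
    qed
    have 2: "re (rm (d x n) c) = \<phi> (Suc n) - \<psi> n" for n
      unfolding d_def g_def[symmetric] oassoc_def ocomp_def \<phi>_def \<psi>_def w_def
        oCJ_commute[OF J c opow_oCJ[OF J oinv_oCJ[OF J s]]]
      by (simp only: add_simps linear_diff[OF linear_re] re_rm_rm re_oext re_g)
    note S1 = bounded_linear_suminf_eq[OF bl st[of "oR rm s x - T x"], unfolded 1]
    note S2 = bounded_linear_suminf_eq[OF bl sd[of x], unfolded 2]
    \<comment> \<open>The \<open>\<psi>\<close> terms cancel termwise, so their separate summability
      does not enter; \<open>\<phi>\<close> telescopes.\<close>
    have 3: "(\<Sum>n. \<phi> n - \<psi> n) - (\<Sum>n. \<phi> (Suc n) - \<psi> n) = (\<Sum>n. \<phi> n - \<phi> (Suc n))"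
      using suminf_diff[OF S1(2) S2(2)] by simp
    have "summable \<phi>"
    proof (rule summable_power_bound[OF onorm_pos_le[OF bT] ns])
      fix n
      \<comment> \<open>The common bound has one more inverse power, which is compensated by a
        constant factor \<open>norm s\<close>.\<close>
      have e: "inverse (norm s) ^ n = norm s * inverse (norm s) ^ Suc n" using s0 by simp
      have "norm (\<phi> n) \<le> norm ((T ^^ n) (rm x (omul c (opow (oinv s) n)))) * k"
        unfolding \<phi>_def by (rule k)
      also have "\<dots> \<le> onorm T ^ n * norm (rm x (omul c (opow (oinv s) n))) * k"
        using norm_funpow_le[OF bT] k(2) by (intro mult_right_mono) auto
      also have "norm (rm x (omul c (opow (oinv s) n))) = norm c * inverse (norm s) ^ n * norm x"
        by (simp add: norm_rm norm_omul_oCJ[OF J c opow_oCJ[OF J oinv_oCJ[OF J s]]]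
            norm_opow[OF J oinv_oCJ[OF J s]] norm_oinv)
      finally show "norm (\<phi> n) \<le> (norm c * norm x * k * norm s) * onorm T ^ n * inverse (norm s) ^ Suc n"
        unfolding e by (simp only: mult_ac)
    qed
    then have "\<phi> \<longlonglongrightarrow> 0" by (rule summable_LIMSEQ_zero)
    then have "(\<Sum>n. \<phi> n - \<phi> (Suc n)) = \<phi> 0"
      using telescope_sums'[of \<phi> 0] by (simp add: sums_unique[symmetric])
    moreover have "\<phi> 0 = re (rm x c)"
      by (simp add: \<phi>_def)
    ultimately show ?thesis
      using 3 S1(1) S2(1) by (simp add: add_simps linear_add[OF linear_re] algebra_simps)
  qed
  have "opi lm rm J (suminf (t (oR rm s x - T x))) = opi lm rm J (x + suminf (d x))"
    \<comment> \<open>The test elements c = 1 and c = \<open>ocnj J\<close> suffice to determine the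
      projection.\<close>
    using re_sums[OF oCJ_basic(1)] re_sums[OF ocnj_oCJ[OF J oCJ_basic(2)]] by (intro opi_eqI) simp_all
  then show "opi lm rm J (suminf (t (oR rm s x - T x))) = opi lm rm J x + opi lm rm J (suminf (d x))"
    by (simp add: opi_def add_simps linear_add[OF linear_re])
qed

end

theorem mainTheorem1:
  fixes lm :: "octo \<Rightarrow> 'v::banach \<Rightarrow> 'v" and rm :: "'v \<Rightarrow> octo \<Rightarrow> 'v"
    and T :: "'v \<Rightarrow> 'v" and J s :: octo
  assumes V: "banach_obimodule lm rm"
    and T: "T \<in> BRO lm rm"
    and J: "J \<in> oS"
    and s: "s \<in> oCJ J"
    and ns: "norm s > onorm T"
  shows
    "(\<forall>x \<in> oCJV lm rm J.
        summable (\<lambda>n. oract lm rm (orpow lm rm T n) (opow (oinv s) (Suc n)) x) \<and>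
        summable (\<lambda>n. oassoc lm rm T (orpow lm rm T n) (rm x (opow (oinv s) (Suc n)))) \<and>
        oR rm s (\<Sum>n. oract lm rm (orpow lm rm T n) (opow (oinv s) (Suc n)) x)
          - T (\<Sum>n. oract lm rm (orpow lm rm T n) (opow (oinv s) (Suc n)) x)
        = x + (\<Sum>n. oassoc lm rm T (orpow lm rm T n) (rm x (opow (oinv s) (Suc n)))))
   \<and>
    (\<forall>x.
        (\<forall>y. summable (\<lambda>n. olact lm rm (opow (oinv s) (Suc n)) (olpow lm rm T n) y)) \<and>
        summable (\<lambda>n. rm (oassoc lm rm (olpow lm rm T n) T x) (opow (oinv s) (Suc n))) \<and>
        opi lm rm J (\<Sum>n. olact lm rm (opow (oinv s) (Suc n)) (olpow lm rm T n) (oR rm s x - T x))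
        = opi lm rm J x + opi lm rm J (\<Sum>n. rm (oassoc lm rm (olpow lm rm T n) T x) (opow (oinv s) (Suc n))))"
proof -
  interpret banach_octonion_bimodule lm rm by unfold_locales (rule V)
  have bT: "bounded_linear T" using T by (simp add: BRO_def)
  note R = right_resolvent_series[OF bT J s ns] and L = left_resolvent_series[OF T J s ns]
  show ?thesis by (intro conjI ballI allI R L)
qed

end
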